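(* Let $Q$ be the Dynkin quiver of the corresponding $ADE$ type with alternating orientation of edges, and let $\Sigma_0=(\mathbf x,Q\boxtimes A_\infty)$ be the initial seed of the Hernandez-Leclerc cluster algebra $\mathcal A_Q$. Let $\mathbf N$ be a finite nested collection of intervals $[a+1,a+b]=\{a+1,\dots,a+b\}$ (with $a\ge 0$, $b\ge 1$ integers), and let $\mathcal M_{\mathbf N}=\{W^{(v)}_{b,a+b}\mid v\in V_Q,\ [a+1,a+b]\in\mathbf N\}$ be the corresponding collection of Kirillov-Reshetikhin modules. Then there exists a finite sink green sequence of mutations $\mathcal S_{\mathbf N}$ such that the seed $\Sigma'=\Sigma_0\mathcal S_{\mathbf N}$ contains cluster variables whose $g$-vectors take the form $$e_{(v,a+b)}-e_{(v,a)},\qquad [a+1,a+b]\in\mathbf N,\ v\in V_Q.$$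
   Context: Quivers have no loops or oriented 2-cycles. A seed is a pair $(\mathbf x,R)$ of a quiver $R$ and variables $\mathbf x=(x_u)_{u\in V_R}$. Mutation $\mu_v$ mutates the quiver as usual (for each path $u\to v\to w$ add an arrow $u\to w$; reverse all arrows at $v$; cancel oriented 2-cycles) and replaces $x_v$ by $\big(\prod_{u\to v}x_u+\prod_{v\to w}x_w\big)/x_v$ (products over arrows). A sequence $\mathcal S$ of vertices is applied from left to right; the results are written $\Sigma\mathcal S$, $R\mathcal S$. The cluster algebra $\mathcal A_Q$ is generated by all variables of seeds obtained from $\Sigma_0$ by finitely many mutations. The framed quiver $\overline R$ is obtained from $R$ by adding for each vertex $v$ a frozen vertex $\bar v$ and an arrow $v\to\bar v$. In a quiver obtained from $\overline R$ by mutations at non-added vertices, a mutable vertex is green if no arrow goes from an added frozen vertex to it. A sequence $(v_1,\dots,v_m)$ is a green sequence if each $v_j$ is green in $\overline R(v_1,\dots,v_{j-1})$. It is a sink sequence (sink green sequence) if each $v_j$ is a green vertex which is a sink of $R(v_1,\dots,v_{j-1})$. $F$-polynomials and $g$-vectors (relative to $\Sigma_0=(\mathbf x,R)$): put $y_v=\prod_{v\to u}x_u/\prod_{w\to v}x_w$ (arrows of $R$). The $F$-polynomial $F$ of a cluster variable $z$ obtained by a mutation sequence is obtained by performing that sequence on the framed quiver $\overline R$ and then setting $x_u=1$ for $u\in V_R$ and $x_{\bar u}=y_u$; the $g$-vector of $z$ is the unique integer vector $g$ with $z=\mathbf x^{g}F(\mathbf y)$. Here $e_u$ denotes the unit vector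 at vertex $u$, with the convention $e_{(v,0)}=0$. An alternating orientation of an $ADE$ Dynkin diagram is one in which every vertex is a source or a sink. $A_\infty$ is the quiver with vertices $1,2,3,\dots$ and arrows $i+1\to i$. The triangular product $Q\boxtimes R$ has vertex set $V_Q\times V_R$ and arrows: $(u,r)\to(u',r)$ for each arrow $u\to u'$ of $Q$ and $r\in V_R$; $(u,r)\to(u,r')$ for each $u\in V_Q$ and arrow $r\to r'$ of $R$; and $(u',r')\to(u,r)$ for each pair of arrows $u\to u'$ of $Q$ and $r\to r'$ of $R$. A collection of intervals of integers is nested if for any two of its members one contains the other. Kirillov-Reshetikhin modules: consider the untwisted quantum affine algebra $U_q(\hat{\mathfrak g})$ of type $A_n^{(1)}$, $D_n^{(1)}$, $E_6^{(1)}$, $E_7^{(1)}$ or $E_8^{(1)}$, with $Q$ of the corresponding type $A_n$, $D_n$, $E_6$, $E_7$, $E_8$. Its irreducible finite-dimensional representations are parametrized by the highest dominant monomials of their $q$-characters in variables $Y_{i,c}$. Write $t_{v,j}=Y_{v,q^{-2j+2}}$ if $v$ is a source of $Q$ and $t_{v,j}=Y_{v,q^{-2j+1}}$ if $v$ is a sink. Then $W^{(v)}_{k,r+k}$ denotes the irreducible representation with highest monomial $\prod_{j=1}^{k}t_{v,r+j}$, and $[r+1,r+k]$ is called the support of this monomial. Thus $\mathcal M_{\mathbf N}$ consists of the Kirillov-Reshetikhin modules whose supports of dominant monomials lie in $\mathbf N$.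
   Formalization: Unless Q is A_1, Q⊠A_∞ has no sinks, so "sink green sequence" is read as a green sequence of Q⊠A_∞ obtained from a sink green sequence of A_∞ by replacing each mutation at r with mutations at all (u,r), sources u of Q first, then sinks. *)

theory Defs
  imports
    "HOL-Library.Poly_Mapping"
    "HOL-Library.Product_Lexorder"
    "HOL-Computational_Algebra.Fraction_Field"
begin

section \<open>Quivers and mutation\<close>

text \<open>\<open>arr R u w\<close> is the number of arrows from \<open>u\<close> to \<open>w\<close>. Vertex sets may be infinite, but every
  quiver below is locally finite.\<close>

record 'v quiver =
  verts :: "'v set"
  arr :: "'v \<Rightarrow> 'v \<Rightarrow> nat"

definition is_source :: "'v quiver \<Rightarrow> 'v \<Rightarrow> bool" where
  "is_source R v \<longleftrightarrow> (\<forall>w. arr R w v = 0)"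

definition is_sink :: "'v quiver \<Rightarrow> 'v \<Rightarrow> bool" where
  "is_sink R v \<longleftrightarrow> (\<forall>w. arr R v w = 0)"

text \<open>Between vertices different from \<open>v\<close>, the truncated subtraction on \<open>nat\<close> is the cancellation of a
  maximal family of oriented 2-cycles.\<close>

definition mutate :: "'v quiver \<Rightarrow> 'v \<Rightarrow> 'v quiver" where
  "mutate R v =
    \<lparr>verts = verts R,
     arr = (\<lambda>u w.
       if u = v \<or> w = v then arr R w u
       else (arr R u w + arr R u v * arr R v w) - (arr R w u + arr R w v * arr R v u))\<rparr>"

definition mutate_list :: "'v quiver \<Rightarrow> 'v list \<Rightarrow> 'v quiver" where
  "mutate_list R S = foldl mutate R S"


section \<open>Green sequences\<close>

text \<open>Vertices of a framed quiver are pairs: \<open>(v, False)\<close> is the original vertex \<open>v\<close>, and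
  \<open>(v, True)\<close> is the added frozen vertex.\<close>

abbreviation mut :: "'v \<Rightarrow> 'v \<times> bool" where "mut v \<equiv> (v, False)"
abbreviation frz :: "'v \<Rightarrow> 'v \<times> bool" where "frz v \<equiv> (v, True)"

definition framed :: "'v quiver \<Rightarrow> ('v \<times> bool) quiver" where
  "framed R =
    \<lparr>verts = mut ` verts R \<union> frz ` verts R,
     arr = (\<lambda>(u, i) (w, j).
       if \<not> i \<and> \<not> j then arr R u w
       else if \<not> i \<and> j \<and> u = w \<and> u \<in> verts R then 1 else 0)\<rparr>"

definition is_green :: "('v \<times> bool) quiver \<Rightarrow> 'v \<Rightarrow> bool" where
  "is_green F v \<longleftrightarrow> (\<forall>u. arr F (frz u) (mut v) = 0)"

definition green_sequence :: "'v quiver \<Rightarrow> 'v list \<Rightarrow> bool" where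
  "green_sequence R S \<longleftrightarrow>
    (\<forall>j < length S. S ! j \<in> verts R \<and>
       is_green (mutate_list (framed R) (map mut (take j S))) (S ! j))"

definition sink_green_sequence :: "'v quiver \<Rightarrow> 'v list \<Rightarrow> bool" where
  "sink_green_sequence R S \<longleftrightarrow>
    green_sequence R S \<and> (\<forall>j < length S. is_sink (mutate_list R (take j S)) (S ! j))"


section \<open>Seeds\<close>

text \<open>The fields in which seeds live: \<open>'v \<Rightarrow>\<^sub>0 nat\<close> are the monomials in indeterminates
  indexed by \<open>'v\<close>, and \<open>'v ratfun\<close> is the field of rational functions over the rationals in these
  indeterminates. The linear order on \<open>'v\<close> is only needed for the library's proof that polynomials
  form an integral domain.\<close>

type_synonym 'v mpoly = "('v \<Rightarrow>\<^sub>0 nat) \<Rightarrow>\<^sub>0 int"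
type_synonym 'v ratfun = "(('v \<Rightarrow>\<^sub>0 nat) \<Rightarrow>\<^sub>0 int) fract"

definition indet :: "'v::linorder \<Rightarrow> 'v ratfun" where
  "indet u = Fract (Poly_Mapping.single (Poly_Mapping.single u 1) 1) 1"

type_synonym ('v, 'k) seed = "'v quiver \<times> ('v \<Rightarrow> 'k)"

definition mutate_seed :: "('v, 'k::field) seed \<Rightarrow> 'v \<Rightarrow> ('v, 'k) seed" where
  "mutate_seed \<Sigma> v = (case \<Sigma> of (R, x) \<Rightarrow>
    (mutate R v,
     x(v := ((\<Prod>u | arr R u v \<noteq> 0. x u ^ arr R u v) +
             (\<Prod>w | arr R v w \<noteq> 0. x w ^ arr R v w)) / x v)))"

definition mutate_seed_list :: "('v, 'k::field) seed \<Rightarrow> 'v list \<Rightarrow> ('v, 'k) seed" where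
  "mutate_seed_list \<Sigma> S = foldl mutate_seed \<Sigma> S"

definition initial_seed :: "'v::linorder quiver \<Rightarrow> ('v, 'v ratfun) seed" where
  "initial_seed R = (R, indet)"


section \<open>F-polynomials and g-vectors\<close>

definition eval_mpoly :: "('v \<Rightarrow> 'k::comm_ring_1) \<Rightarrow> 'v mpoly \<Rightarrow> 'k" where
  "eval_mpoly \<phi> p =
    (\<Sum>m \<in> Poly_Mapping.keys p.
       of_int (Poly_Mapping.lookup p m) *
       (\<Prod>u \<in> Poly_Mapping.keys m. \<phi> u ^ Poly_Mapping.lookup m u))"

text \<open>Substitution into a rational function that has a representation whose denominator does not
  vanish under the substitution; the value does not depend on the representation.\<close>

definition eval_ratfun :: "('v::linorder \<Rightarrow> 'k::field) \<Rightarrow> 'v ratfun \<Rightarrow> 'k" where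
  "eval_ratfun \<phi> r =
    (THE c. \<exists>p q. r = Fract p q \<and> eval_mpoly \<phi> q \<noteq> 0 \<and> c = eval_mpoly \<phi> p / eval_mpoly \<phi> q)"

definition y_var :: "'v::linorder quiver \<Rightarrow> 'v \<Rightarrow> 'v ratfun" where
  "y_var R v =
    (\<Prod>u | arr R v u \<noteq> 0. indet u ^ arr R v u) / (\<Prod>w | arr R w v \<noteq> 0. indet w ^ arr R w v)"

text \<open>\<open>F(y)\<close> for the variable at \<open>w\<close> in the seed reached by \<open>S\<close>: perform \<open>S\<close> on the framed quiver,
  then set the original initial variables to 1 and the frozen variable at \<open>u\<close> to \<open>y_var R u\<close>.\<close>

definition F_at_y :: "'v::linorder quiver \<Rightarrow> 'v list \<Rightarrow> 'v \<Rightarrow> 'v ratfun" where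
  "F_at_y R S w =
    eval_ratfun (\<lambda>(u, fr). if fr then y_var R u else 1)
      (snd (mutate_seed_list (initial_seed (framed R)) (map mut S)) (mut w))"

definition monomial_x :: "('v::linorder \<Rightarrow>\<^sub>0 int) \<Rightarrow> 'v ratfun" where
  "monomial_x g = (\<Prod>u \<in> Poly_Mapping.keys g. indet u powi Poly_Mapping.lookup g u)"

text \<open>\<open>g\<close> is the g-vector of the cluster variable at \<open>w\<close> of the seed reached by \<open>S\<close>. There is at most
  one such \<open>g\<close>, as distinct Laurent monomials are distinct rational functions.\<close>

definition is_g_vector :: "'v::linorder quiver \<Rightarrow> 'v list \<Rightarrow> 'v \<Rightarrow> ('v \<Rightarrow>\<^sub>0 int) \<Rightarrow> bool" where
  "is_g_vector R S w g \<longleftrightarrow>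
    snd (mutate_seed_list (initial_seed R) S) w = monomial_x g * F_at_y R S w"


section \<open>Dynkin quivers, the infinite linear quiver, and triangular products\<close>

datatype dynkin_type = A nat | D nat | E nat

fun dynkin_valid :: "dynkin_type \<Rightarrow> bool" where
  "dynkin_valid (A n) \<longleftrightarrow> n \<ge> 1"
| "dynkin_valid (D n) \<longleftrightarrow> n \<ge> 4"
| "dynkin_valid (E n) \<longleftrightarrow> n \<in> {6, 7, 8}"

fun rank :: "dynkin_type \<Rightarrow> nat" where
  "rank (A n) = n"
| "rank (D n) = n"
| "rank (E n) = n"

text \<open>Bourbaki labelling by \<open>1, \<dots>, n\<close>; each edge is listed once, with \<open>i < j\<close>.\<close>

fun dynkin_edge :: "dynkin_type \<Rightarrow> nat \<Rightarrow> nat \<Rightarrow> bool" where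
  "dynkin_edge (A n) i j \<longleftrightarrow> 1 \<le> i \<and> j = i + 1 \<and> j \<le> n"
| "dynkin_edge (D n) i j \<longleftrightarrow> (1 \<le> i \<and> j = i + 1 \<and> j \<le> n - 1) \<or> (i = n - 2 \<and> j = n)"
| "dynkin_edge (E n) i j \<longleftrightarrow>
    (i = 1 \<and> j = 3) \<or> (i = 2 \<and> j = 4) \<or> (3 \<le> i \<and> j = i + 1 \<and> j \<le> n)"

definition alternating_dynkin_quiver :: "dynkin_type \<Rightarrow> nat quiver \<Rightarrow> bool" where
  "alternating_dynkin_quiver T Q \<longleftrightarrow>
    dynkin_valid T \<and>
    verts Q = {1..rank T} \<and>
    (\<forall>i j. arr Q i j + arr Q j i = (if dynkin_edge T i j \<or> dynkin_edge T j i then 1 else 0)) \<and>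
    (\<forall>v \<in> verts Q. is_source Q v \<or> is_sink Q v)"

definition A_infinity :: "nat quiver" where
  "A_infinity =
    \<lparr>verts = {1..}, arr = (\<lambda>i j. if 1 \<le> j \<and> i = j + 1 then 1 else 0)\<rparr>"

definition triangular_product :: "'u quiver \<Rightarrow> 'v quiver \<Rightarrow> ('u \<times> 'v) quiver" (infixl "\<boxtimes>" 70) where
  "Q \<boxtimes> R =
    \<lparr>verts = verts Q \<times> verts R,
     arr = (\<lambda>(u, r) (u', r').
       (if r = r' \<and> r \<in> verts R then arr Q u u' else 0) +
       (if u = u' \<and> u \<in> verts Q then arr R r r' else 0) +
       arr Q u' u * arr R r' r)\<rparr>"

text \<open>As soon as \<open>Q\<close> has an arrow at \<open>u\<close>, no vertex \<open>(u, k)\<close> of \<open>Q \<boxtimes> A_infinity\<close> is a sink. A sink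
  sequence for \<open>Q \<boxtimes> A_infinity\<close> is therefore a sink sequence in the direction of \<open>A_infinity\<close>: it
  comes from a sink sequence of \<open>A_infinity\<close>, where a mutation at \<open>r\<close> is carried out at all vertices
  \<open>(u, r)\<close>, first for the sources and then for the sinks \<open>u\<close> of \<open>Q\<close>. (For \<open>Q\<close> alternating and \<open>r\<close> a
  sink of \<open>R\<close>, this turns \<open>Q \<boxtimes> R\<close> into the triangular product of \<open>Q\<close> with the mutation of \<open>R\<close> at
  \<open>r\<close>.)\<close>

lemma no_sink_triangular_product:
  assumes "is_source Q u \<or> is_sink Q u" "arr Q u u' + arr Q u' u \<noteq> 0" "k \<ge> 1"
  shows "\<not> is_sink (Q \<boxtimes> A_infinity) (u, k)"
proof -
  have "arr (Q \<boxtimes> A_infinity) (u, k) (u', k) \<noteq> 0" if "arr Q u u' \<noteq> 0"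
    using that assms(3) by (simp add: triangular_product_def A_infinity_def)
  moreover have "arr (Q \<boxtimes> A_infinity) (u, k) (u', k + 1) \<noteq> 0" if "arr Q u' u \<noteq> 0"
    using that assms(3) by (simp add: triangular_product_def A_infinity_def)
  ultimately show ?thesis
    using assms(2) unfolding is_sink_def by (metis add_is_0)
qed

text \<open>Mutations at different sources (or at different sinks) of \<open>Q\<close> with the same \<open>r\<close> commute, so
  listing them in increasing order is immaterial. The isolated vertex of \<open>A 1\<close> is listed once.\<close>

definition source_sink_list :: "nat quiver \<Rightarrow> nat list" where
  "source_sink_list Q =
    sorted_list_of_set {u \<in> verts Q. is_source Q u} @
    sorted_list_of_set {u \<in> verts Q. \<not> is_source Q u}"

definition lift_sequence :: "nat quiver \<Rightarrow> 'v list \<Rightarrow> (nat \<times> 'v) list" where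
  "lift_sequence Q S = concat (map (\<lambda>r. map (\<lambda>u. (u, r)) (source_sink_list Q)) S)"


section \<open>Intervals\<close>

definition nested :: "nat set set \<Rightarrow> bool" where
  "nested N \<longleftrightarrow> (\<forall>I \<in> N. \<forall>J \<in> N. I \<subseteq> J \<or> J \<subseteq> I)"

text \<open>Unit vectors of the lattice of g-vectors for \<open>Q \<boxtimes> A_infinity\<close>, with \<open>e (v, 0) = 0\<close>.\<close>

definition e :: "nat \<times> nat \<Rightarrow> (nat \<times> nat \<Rightarrow>\<^sub>0 int)" where
  "e p = (if snd p = 0 then 0 else Poly_Mapping.single p 1)"

end

theory Submission
  imports Defs "HOL.Rat"
begin

text \<open>
  Call \<open>\<alpha> (v, k)\<close> the number of times the vertex \<open>(v, k)\<close> has been mutated. Along a lifted sink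
  sequence of \<open>A_infinity\<close> the framed quiver is a function of \<open>\<alpha>\<close>, and the exchange relations are
  those of a T-system: the arrows into the mutated vertex \<open>(v, k)\<close> come from \<open>(v, k - 1)\<close> and
  \<open>(v, k + 1)\<close>, those out of it go to the \<open>(u, k)\<close> with \<open>u\<close> adjacent to \<open>v\<close>, and its frozen
  arrows go to the copies of \<open>(v, j)\<close>, \<open>a + 1 \<le> j \<le> a + k\<close>, where \<open>a = \<alpha> (v, k)\<close>; so it is green. The
  product of the corresponding \<open>y\<close>-variables telescopes, which shows inductively that the variable
  at \<open>(v, k)\<close> has g-vector \<open>e (v, a + k) - e (v, a)\<close>. It remains to find a sink sequence of
  \<open>A_infinity\<close> that mutates \<open>b\<close> exactly \<open>a\<close> times whenever \<open>{a + 1..a + b} \<in> N\<close>. Nestedness lets one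
  extend \<open>b \<mapsto> a\<close> to a function \<open>p\<close> of all lengths that drops by 0 or 1 at each step and vanishes
  eventually; the sequence consists of rounds \<open>1, \<dots>, m\<^sub>t\<close>, where \<open>m\<^sub>t\<close> is the number of \<open>k\<close> with
  \<open>p k \<ge> t\<close>.
\<close>

section \<open>Evaluation of rational functions\<close>

lemma keys_add_nat:
  fixes m n :: "'a \<Rightarrow>\<^sub>0 nat"
  shows "Poly_Mapping.keys (m + n) = Poly_Mapping.keys m \<union> Poly_Mapping.keys n"
  by (auto simp: in_keys_iff lookup_add)

definition mon_eval :: "('v \<Rightarrow> 'k::comm_ring_1) \<Rightarrow> ('v \<Rightarrow>\<^sub>0 nat) \<Rightarrow> 'k" where
  "mon_eval \<phi> m = (\<Prod>u \<in> Poly_Mapping.keys m. \<phi> u ^ Poly_Mapping.lookup m u)"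

lemma mon_eval_superset:
  assumes "finite K" "Poly_Mapping.keys m \<subseteq> K"
  shows "mon_eval \<phi> m = (\<Prod>u \<in> K. \<phi> u ^ Poly_Mapping.lookup m u)"
  unfolding mon_eval_def
  by (rule prod.mono_neutral_left) (use assms in \<open>auto simp: in_keys_iff\<close>)

lemma mon_eval_add: "mon_eval \<phi> (m + n) = mon_eval \<phi> m * mon_eval \<phi> n"
proof -
  let ?K = "Poly_Mapping.keys m \<union> Poly_Mapping.keys n"
  have "mon_eval \<phi> (m + n) = (\<Prod>u \<in> ?K. \<phi> u ^ Poly_Mapping.lookup (m + n) u)"
    by (rule mon_eval_superset) (auto simp: keys_add_nat)
  also have "\<dots> = mon_eval \<phi> m * mon_eval \<phi> n"
    by (simp add: mon_eval_superset[of ?K] lookup_add power_add prod.distrib)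
  finally show ?thesis .
qed

lemma eval_mpoly_superset:
  assumes "finite K" "Poly_Mapping.keys p \<subseteq> K"
  shows "eval_mpoly \<phi> p = (\<Sum>m \<in> K. of_int (Poly_Mapping.lookup p m) * mon_eval \<phi> m)"
  unfolding eval_mpoly_def mon_eval_def
  by (rule sum.mono_neutral_left) (use assms in \<open>auto simp: in_keys_iff\<close>)

lemma eval_mpoly_0 [simp]: "eval_mpoly \<phi> 0 = 0"
  by (simp add: eval_mpoly_def)

lemma eval_mpoly_add: "eval_mpoly \<phi> (p + q) = eval_mpoly \<phi> p + eval_mpoly \<phi> q"
proof -
  let ?K = "Poly_Mapping.keys p \<union> Poly_Mapping.keys q"
  have "eval_mpoly \<phi> (p + q) =
      (\<Sum>m \<in> ?K. of_int (Poly_Mapping.lookup (p + q) m) * mon_eval \<phi> m)"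
    by (rule eval_mpoly_superset) (use Poly_Mapping.keys_add[of p q] in auto)
  also have "\<dots> = eval_mpoly \<phi> p + eval_mpoly \<phi> q"
    by (simp add: eval_mpoly_superset[of ?K] lookup_add algebra_simps sum.distrib)
  finally show ?thesis .
qed

lemma eval_mpoly_sum: "eval_mpoly \<phi> (sum f I) = (\<Sum>i \<in> I. eval_mpoly \<phi> (f i))"
  by (induction I rule: infinite_finite_induct) (auto simp: eval_mpoly_add)

lemma eval_mpoly_single: "eval_mpoly \<phi> (Poly_Mapping.single m c) = of_int c * mon_eval \<phi> m"
  by (simp add: eval_mpoly_superset[of "{m}"])

lemma mpoly_eq_sum_single:
  fixes p :: "'v mpoly"
  shows "p = (\<Sum>m \<in> Poly_Mapping.keys p. Poly_Mapping.single m (Poly_Mapping.lookup p m))"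
  by (rule poly_mapping_eqI) (auto simp: lookup_sum lookup_single when_def in_keys_iff)

lemma eval_mpoly_mult: "eval_mpoly \<phi> (p * q) = eval_mpoly \<phi> p * eval_mpoly \<phi> q"
proof -
  \<comment> \<open>Both factors are expanded into terms; on a pair of terms multiplicativity is
    \<open>mon_eval_add\<close>.\<close>
  have "p * q = (\<Sum>m \<in> Poly_Mapping.keys p. \<Sum>n \<in> Poly_Mapping.keys q.
      Poly_Mapping.single (m + n) (Poly_Mapping.lookup p m * Poly_Mapping.lookup q n))"
    by (subst (1) mpoly_eq_sum_single[of p], subst (1) mpoly_eq_sum_single[of q])
      (simp add: sum_product mult_single)
  then have "eval_mpoly \<phi> (p * q) = (\<Sum>m \<in> Poly_Mapping.keys p. \<Sum>n \<in> Poly_Mapping.keys q.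
      (of_int (Poly_Mapping.lookup p m) * mon_eval \<phi> m) *
      (of_int (Poly_Mapping.lookup q n) * mon_eval \<phi> n))"
    by (simp add: eval_mpoly_sum eval_mpoly_single mon_eval_add mult_ac)
  also have "\<dots> = eval_mpoly \<phi> p * eval_mpoly \<phi> q"
    by (simp add: sum_product eval_mpoly_superset[OF finite_keys subset_refl])
  finally show ?thesis .
qed

lemma eval_mpoly_1 [simp]: "eval_mpoly \<phi> 1 = 1"
  by (simp add: single_one[symmetric] eval_mpoly_single mon_eval_def del: single_one)

text \<open>The predicate under the \<open>THE\<close> of \<open>eval_ratfun\<close>. As a relation
  it passes through the field operations, while \<open>eval_ratfun\<close> is meaningful only once a
  representation with nonvanishing denominator is known.\<close>

definition evaluates_to :: "('v::linorder \<Rightarrow> 'k::field) \<Rightarrow> 'v ratfun \<Rightarrow> 'k \<Rightarrow> bool" where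
  "evaluates_to \<phi> r c \<longleftrightarrow>
    (\<exists>p q. r = Fraction_Field.Fract p q \<and> eval_mpoly \<phi> q \<noteq> 0 \<and> c = eval_mpoly \<phi> p / eval_mpoly \<phi> q)"

lemma evaluates_toE:
  assumes "evaluates_to \<phi> r c"
  obtains p q where "r = Fraction_Field.Fract p q" "q \<noteq> 0" "eval_mpoly \<phi> q \<noteq> 0"
    "c = eval_mpoly \<phi> p / eval_mpoly \<phi> q"
  using assms unfolding evaluates_to_def by (metis eval_mpoly_0)

text \<open>Two representations of one fraction agree after cross-multiplication, evaluation
  respects products, and both evaluated denominators are nonzero.\<close>

lemma evaluates_to_unique:
  assumes "evaluates_to \<phi> r c" "evaluates_to \<phi> r d"
  shows "c = d"
proof -
  obtain p q where 1: "r = Fraction_Field.Fract p q" "q \<noteq> 0" "eval_mpoly \<phi> q \<noteq> 0"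
    "c = eval_mpoly \<phi> p / eval_mpoly \<phi> q" using assms(1) by (rule evaluates_toE)
  obtain p' q' where 2: "r = Fraction_Field.Fract p' q'" "q' \<noteq> 0" "eval_mpoly \<phi> q' \<noteq> 0"
    "d = eval_mpoly \<phi> p' / eval_mpoly \<phi> q'" using assms(2) by (rule evaluates_toE)
  have "p * q' = p' * q"
    using 1 2 by (metis eq_fract(1))
  then have "eval_mpoly \<phi> p * eval_mpoly \<phi> q' = eval_mpoly \<phi> p' * eval_mpoly \<phi> q"
    by (metis eval_mpoly_mult)
  then show ?thesis using 1 2 by (simp add: frac_eq_eq)
qed

lemma eval_ratfun_eqI: "evaluates_to \<phi> r c \<Longrightarrow> eval_ratfun \<phi> r = c"
  unfolding eval_ratfun_def evaluates_to_def[symmetric]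
  by (blast intro: the_equality evaluates_to_unique)

lemma evaluates_to_indet: "evaluates_to \<phi> (indet u) (\<phi> u)"
  unfolding evaluates_to_def indet_def
  by (intro exI[of _ "Poly_Mapping.single (Poly_Mapping.single u 1) 1"] exI[of _ 1])
    (simp add: eval_mpoly_single mon_eval_def)

lemma evaluates_to_1: "evaluates_to \<phi> 1 1"
  unfolding evaluates_to_def One_fract_def by (intro exI[of _ 1]) simp

lemma evaluates_to_add:
  assumes "evaluates_to \<phi> r c" "evaluates_to \<phi> s d"
  shows "evaluates_to \<phi> (r + s) (c + d)"
proof -
  obtain p q where 1: "r = Fraction_Field.Fract p q" "q \<noteq> 0" "eval_mpoly \<phi> q \<noteq> 0"
    "c = eval_mpoly \<phi> p / eval_mpoly \<phi> q" using assms(1) by (rule evaluates_toE)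
  obtain p' q' where 2: "s = Fraction_Field.Fract p' q'" "q' \<noteq> 0" "eval_mpoly \<phi> q' \<noteq> 0"
    "d = eval_mpoly \<phi> p' / eval_mpoly \<phi> q'" using assms(2) by (rule evaluates_toE)
  show ?thesis unfolding evaluates_to_def
    by (intro exI[of _ "p * q' + p' * q"] exI[of _ "q * q'"])
      (use 1 2 in \<open>simp add: eval_mpoly_mult eval_mpoly_add add_frac_eq\<close>)
qed

lemma evaluates_to_mult:
  assumes "evaluates_to \<phi> r c" "evaluates_to \<phi> s d"
  shows "evaluates_to \<phi> (r * s) (c * d)"
proof -
  obtain p q where 1: "r = Fraction_Field.Fract p q" "q \<noteq> 0" "eval_mpoly \<phi> q \<noteq> 0"
    "c = eval_mpoly \<phi> p / eval_mpoly \<phi> q" using assms(1) by (rule evaluates_toE)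
  obtain p' q' where 2: "s = Fraction_Field.Fract p' q'" "q' \<noteq> 0" "eval_mpoly \<phi> q' \<noteq> 0"
    "d = eval_mpoly \<phi> p' / eval_mpoly \<phi> q'" using assms(2) by (rule evaluates_toE)
  show ?thesis unfolding evaluates_to_def
    by (intro exI[of _ "p * p'"] exI[of _ "q * q'"])
      (use 1 2 in \<open>simp add: eval_mpoly_mult\<close>)
qed

lemma evaluates_to_divide:
  assumes "evaluates_to \<phi> r c" "evaluates_to \<phi> s d" "d \<noteq> 0"
  shows "evaluates_to \<phi> (r / s) (c / d)"
proof -
  obtain p q where 1: "r = Fraction_Field.Fract p q" "q \<noteq> 0" "eval_mpoly \<phi> q \<noteq> 0"
    "c = eval_mpoly \<phi> p / eval_mpoly \<phi> q" using assms(1) by (rule evaluates_toE)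
  obtain p' q' where 2: "s = Fraction_Field.Fract p' q'" "q' \<noteq> 0" "eval_mpoly \<phi> q' \<noteq> 0"
    "d = eval_mpoly \<phi> p' / eval_mpoly \<phi> q'" using assms(2) by (rule evaluates_toE)
  show ?thesis unfolding evaluates_to_def
    by (intro exI[of _ "p * q'"] exI[of _ "q * p'"])
      (use 1 2 assms(3) in \<open>auto simp add: eval_mpoly_mult\<close>)
qed

lemma evaluates_to_power: "evaluates_to \<phi> r c \<Longrightarrow> evaluates_to \<phi> (r ^ n) (c ^ n)"
  by (induction n) (auto intro: evaluates_to_1 evaluates_to_mult)

lemma evaluates_to_prod:
  assumes "\<And>i. i \<in> I \<Longrightarrow> evaluates_to \<phi> (f i) (g i)"
  shows "evaluates_to \<phi> (prod f I) (prod g I)"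
  using assms
  by (induction I rule: infinite_finite_induct) (auto intro: evaluates_to_1 evaluates_to_mult)

text \<open>Positivity is only a device to see that no cluster variable vanishes.\<close>

definition positive :: "'v::linorder ratfun \<Rightarrow> bool" where
  "positive r \<longleftrightarrow> (\<exists>c > 0. evaluates_to (\<lambda>_. 1 :: rat) r c)"

lemma positive_nonzero:
  assumes "positive r" shows "r \<noteq> 0"
proof
  assume "r = 0"
  moreover have "evaluates_to (\<lambda>_. 1 :: rat) (0 :: 'a ratfun) 0"
    unfolding evaluates_to_def Zero_fract_def by (intro exI[of _ 0] exI[of _ 1]) simp
  ultimately show False
    using assms evaluates_to_unique unfolding positive_def by blast
qed

lemma positive_indet: "positive (indet u)"
  unfolding positive_def using evaluates_to_indet zero_less_one by blast

lemma positive_1: "positive 1"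
  unfolding positive_def using evaluates_to_1 zero_less_one by blast

lemma positive_add: "positive r \<Longrightarrow> positive s \<Longrightarrow> positive (r + s)"
  unfolding positive_def by (metis add_pos_pos evaluates_to_add)

lemma positive_mult: "positive r \<Longrightarrow> positive s \<Longrightarrow> positive (r * s)"
  unfolding positive_def by (metis mult_pos_pos evaluates_to_mult)

lemma positive_divide: "positive r \<Longrightarrow> positive s \<Longrightarrow> positive (r / s)"
  unfolding positive_def by (metis divide_pos_pos evaluates_to_divide less_irrefl)

lemma positive_power: "positive r \<Longrightarrow> positive (r ^ n)"
  by (induction n) (auto intro: positive_1 positive_mult)

lemma positive_prod: "(\<And>i. i \<in> I \<Longrightarrow> positive (f i)) \<Longrightarrow> positive (prod f I)"
  by (induction I rule: infinite_finite_induct) (auto intro: positive_1 positive_mult)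

section \<open>Quivers as skew-symmetric matrices\<close>

text \<open>Arrows are the positive part of a skew-symmetric matrix, so a represented quiver has no
  oriented 2-cycles, and the cancellation in \<open>mutate\<close> becomes subtraction of
  integers.\<close>

definition represents :: "('v \<Rightarrow> 'v \<Rightarrow> int) \<Rightarrow> 'v quiver \<Rightarrow> bool" where
  "represents b R \<longleftrightarrow> (\<forall>x y. arr R x y = nat (b x y) \<and> b y x = - b x y)"

definition mutate_matrix :: "('v \<Rightarrow> 'v \<Rightarrow> int) \<Rightarrow> 'v \<Rightarrow> 'v \<Rightarrow> 'v \<Rightarrow> int" where
  "mutate_matrix b v x y =
    (if x = v \<or> y = v then - b x y
     else b x y + (max 0 (b x v) * max 0 (b v y) - max 0 (b y v) * max 0 (b v x)))"

lemma represents_mutate: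
  assumes "represents b R"
  shows "represents (mutate_matrix b v) (mutate R v)"
  unfolding represents_def
proof (intro allI conjI)
  fix x y
  have arr: "arr R x y = nat (b x y)" and skew: "b y x = - b x y" for x y
    using assms unfolding represents_def by blast+
  \<comment> \<open>By skew-symmetry \<open>p\<close> and \<open>- p\<close> give the arrows in the
    two directions. The truncated difference of the totals is the positive part of their integer
    difference.\<close>
  have trunc: "nat p + nat c * nat d - (nat (- p) + nat c' * nat d') =
      nat (p + (max 0 c * max 0 d - max 0 c' * max 0 d'))" for p c d c' d' :: int
  proof -
    have "max 0 c * max 0 d = int (nat c * nat d)" "max 0 c' * max 0 d' = int (nat c' * nat d')"
      by (auto simp: max_def)
    moreover have "nat p + X - (nat (- p) + Y) = nat (p + (int X - int Y))" for X Y
      by linarith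
    ultimately show ?thesis by (simp only:)
  qed
  show "arr (mutate R v) x y = nat (mutate_matrix b v x y)"
    using trunc[of "b x y" "b x v" "b v y" "b y v" "b v x"] skew[of x y] skew[of x v] skew[of v y]
    by (simp add: mutate_def mutate_matrix_def arr)
  show "mutate_matrix b v y x = - mutate_matrix b v x y"
    using skew[of x y] skew[of x v] skew[of v y] by (simp add: mutate_matrix_def)
qed

text \<open>A mutated entry depends only on arrows among its two end points and the mutated vertex,
  so mutation commutes with restriction to a full subquiver.\<close>

lemma arr_mutate_list_inj:
  assumes "inj f" "\<And>x y. arr R x y = arr R' (f x) (f y)"
  shows "arr (mutate_list R S) x y = arr (mutate_list R' (map f S)) (f x) (f y)"
  using assms(2)
proof (induction S arbitrary: R R' rule: list.induct)
  case Nil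
  then show ?case by (simp add: mutate_list_def)
next
  case (Cons v S)
  have "arr (mutate R v) x y = arr (mutate R' (f v)) (f x) (f y)" for x y
    using assms(1) Cons.prems by (auto simp: mutate_def inj_eq)
  from Cons.IH[OF this] show ?case
    by (simp add: mutate_list_def)
qed

lemma mutate_list_framed:
  "arr (mutate_list R S) x y = arr (mutate_list (framed R) (map mut S)) (mut x) (mut y)"
  by (rule arr_mutate_list_inj) (auto simp: inj_def framed_def)

text \<open>The embedding acts alike on original and frozen copies. This later carries greenness
  over to \<open>A_infinity\<close>, seen as a triangular product with a single row.\<close>

lemma mutate_list_framed_inj:
  assumes "inj f" "\<And>x y. arr R x y = arr R' (f x) (f y)" "\<And>x. x \<in> verts R \<longleftrightarrow> f x \<in> verts R'"
  shows "arr (mutate_list (framed R) (map mut S)) (x, i) (y, j) =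
    arr (mutate_list (framed R') (map mut (map f S))) (f x, i) (f y, j)"
proof -
  have "inj (map_prod f id :: _ \<times> bool \<Rightarrow> _)"
    using assms(1) by (simp add: prod.inj_map)
  moreover have "arr (framed R) x y = arr (framed R') (map_prod f id x) (map_prod f id y)" for x y
    using assms by (cases x; cases y) (auto simp: framed_def inj_eq)
  ultimately show ?thesis
    using arr_mutate_list_inj[of "map_prod f id" "framed R" "framed R'" "map mut S" "(x, i)" "(y, j)"]
    by (simp add: comp_def)
qed


section \<open>The framed quivers of sink sequences\<close>

locale bipartite_quiver =
  fixes Q :: "nat quiver"
  assumes finite_verts: "finite (verts Q)"
    and arr_verts: "arr Q u w \<noteq> 0 \<Longrightarrow> u \<in> verts Q \<and> w \<in> verts Q"
    and source_or_sink: "v \<in> verts Q \<Longrightarrow> is_source Q v \<or> is_sink Q v"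
begin

definition adj :: "nat \<Rightarrow> nat \<Rightarrow> nat" where
  "adj u w = arr Q u w + arr Q w u"

lemma arr_no_2_path: "arr Q u w \<noteq> 0 \<Longrightarrow> arr Q w x = 0"
  using source_or_sink arr_verts unfolding is_source_def is_sink_def by metis

lemma arr_loop [simp]: "arr Q u u = 0"
  using arr_no_2_path by blast

lemma adj_eq: "adj v u = (if is_source Q v then arr Q v u else arr Q u v)"
  using arr_no_2_path[of _ v u] unfolding adj_def is_source_def by auto

lemma adj_verts: "adj u w \<noteq> 0 \<Longrightarrow> u \<in> verts Q \<and> w \<in> verts Q"
  using arr_verts by (auto simp: adj_def)

lemma finite_adj: "finite {u. adj v u \<noteq> 0}"
  by (rule finite_subset[OF _ finite_verts]) (use adj_verts in blast)

lemma adj_source: "adj v u \<noteq> 0 \<Longrightarrow> is_source Q u \<longleftrightarrow> \<not> is_source Q v"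
  by (metis adj_eq is_source_def source_or_sink is_sink_def adj_verts)

text \<open>The signed number of arrows from \<open>x\<close> to \<open>y\<close> is \<open>half \<alpha> x y - half \<alpha> y x\<close>. For adjacent \<open>s\<close>, \<open>t\<close> in
  \<open>Q\<close>, there is a diagonal arrow between \<open>s\<close> and \<open>t\<close> in neighbouring columns only when neither
  column is half way through its mutation, i.e. when \<open>\<alpha>\<close> agrees at \<open>s\<close> and \<open>t\<close> in both.\<close>

definition half :: "(nat \<times> nat \<Rightarrow> nat) \<Rightarrow> nat \<times> nat \<Rightarrow> nat \<times> nat \<Rightarrow> int" where
  "half \<alpha> = (\<lambda>(u, i) (w, j).
     (if u = w \<and> u \<in> verts Q \<and> 1 \<le> j \<and> i = j + 1
      then if \<alpha> (u, i) = \<alpha> (u, j) then 1 else -1 else 0) +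
     int (arr Q u w) *
       (if i = j \<and> 1 \<le> i then if \<alpha> (u, i) = \<alpha> (w, i) then 1 else -1 else 0) +
     int (arr Q w u) *
       (if \<alpha> (u, i) = \<alpha> (w, i) \<and> \<alpha> (u, j) = \<alpha> (w, j) \<and>
           (1 \<le> i \<and> j = i + 1 \<and> \<alpha> (u, i) = \<alpha> (u, j) \<or>
            1 \<le> j \<and> i = j + 1 \<and> \<alpha> (u, j) = \<alpha> (u, i) + 1)
        then 1 else 0))"

text \<open>In row \<open>v\<close> this is, up to sign, a positive root of type A: an interval of
  frozen indices. For \<open>k = 1\<close> there is no left neighbour to compare with, but there
  \<open>[a + 1, a + k]\<close> is the single index \<open>a + k\<close> and
  \<open>[a, a + k - 1]\<close> the single index \<open>a\<close>, so the branches agree in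
  pairs.\<close>

definition c_vector :: "(nat \<times> nat \<Rightarrow> nat) \<Rightarrow> nat \<times> nat \<Rightarrow> nat \<times> nat \<Rightarrow> int" where
  "c_vector \<alpha> = (\<lambda>(v, k) (w, j).
     if v = w \<and> v \<in> verts Q \<and> 1 \<le> k then
       let a = \<alpha> (v, k) in
       if k = 1 \<or> \<alpha> (v, k - 1) \<noteq> a
       then if \<alpha> (v, k + 1) = a then of_bool (a + 1 \<le> j \<and> j \<le> a + k) else - of_bool (j = a)
       else if \<alpha> (v, k + 1) = a then of_bool (j = a + k)
       else - of_bool (a \<le> j \<and> j + 1 \<le> a + k)
     else 0)"

definition state_matrix ::
    "(nat \<times> nat \<Rightarrow> nat) \<Rightarrow> (nat \<times> nat) \<times> bool \<Rightarrow> (nat \<times> nat) \<times> bool \<Rightarrow> int" where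
  "state_matrix \<alpha> = (\<lambda>(x, fx) (y, fy).
     if \<not> fx \<and> \<not> fy then half \<alpha> x y - half \<alpha> y x
     else if \<not> fx \<and> fy then c_vector \<alpha> x y
     else if fx \<and> \<not> fy then - c_vector \<alpha> y x
     else 0)"

definition bump :: "(nat \<times> nat \<Rightarrow> nat) \<Rightarrow> nat \<times> nat \<Rightarrow> nat \<times> nat \<Rightarrow> nat" where
  "bump \<alpha> p = \<alpha>(p := \<alpha> p + 1)"

text \<open>The situation in a left-to-right sweep just before \<open>(v, k)\<close> is mutated,
  with sources preceding sinks inside a column. The guard \<open>2 \<le> k\<close> is there because
  column 0 has no vertices.\<close>

definition admissible :: "(nat \<times> nat \<Rightarrow> nat) \<Rightarrow> nat \<times> nat \<Rightarrow> bool" where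
  "admissible \<alpha> = (\<lambda>(v, k). v \<in> verts Q \<and> 1 \<le> k \<and>
     (\<forall>u \<in> verts Q. \<alpha> (u, k + 1) = \<alpha> (v, k)) \<and>
     (2 \<le> k \<longrightarrow> (\<forall>u \<in> verts Q. \<alpha> (u, k - 1) = \<alpha> (v, k) + 1)) \<and>
     (\<forall>u. adj v u \<noteq> 0 \<longrightarrow> \<alpha> (u, k) = \<alpha> (v, k) + (if is_source Q v then 0 else 1)))"

lemma admissibleD:
  assumes "admissible \<alpha> (v, k)"
  shows "v \<in> verts Q" "1 \<le> k"
    "\<And>u. u \<in> verts Q \<Longrightarrow> \<alpha> (u, Suc k) = \<alpha> (v, k)"
    "\<And>u i. u \<in> verts Q \<Longrightarrow> k = Suc i \<Longrightarrow> 1 \<le> i \<Longrightarrow> \<alpha> (u, i) = \<alpha> (v, k) + 1"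
    "\<And>u. arr Q v u \<noteq> 0 \<Longrightarrow> \<alpha> (u, k) = \<alpha> (v, k)"
    "\<And>u. arr Q u v \<noteq> 0 \<Longrightarrow> \<alpha> (u, k) = \<alpha> (v, k) + 1"
proof -
  note * = assms[unfolded admissible_def, simplified]
  show "v \<in> verts Q" "1 \<le> k" "\<And>u. u \<in> verts Q \<Longrightarrow> \<alpha> (u, Suc k) = \<alpha> (v, k)"
    using * by auto
  show "\<alpha> (u, i) = \<alpha> (v, k) + 1" if "u \<in> verts Q" "k = Suc i" "1 \<le> i" for u i
    using * that by auto
  show "\<alpha> (u, k) = \<alpha> (v, k)" if "arr Q v u \<noteq> 0" for u
  proof -
    have "is_source Q v" using that arr_no_2_path unfolding is_source_def by metis
    then show ?thesis using * that by (auto simp: adj_def)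
  qed
  show "\<alpha> (u, k) = \<alpha> (v, k) + 1" if "arr Q u v \<noteq> 0" for u
  proof -
    have "\<not> is_source Q v" using that unfolding is_source_def by metis
    then show ?thesis using * that by (auto simp: adj_def)
  qed
qed

lemma state_matrix_skew: "state_matrix \<alpha> y x = - state_matrix \<alpha> x y"
  by (auto simp: state_matrix_def split: prod.splits)

lemma state_matrix_initial:
  "represents (state_matrix (\<lambda>_. 0)) (framed (Q \<boxtimes> A_infinity))"
  unfolding represents_def
proof (intro allI conjI)
  fix x y :: "(nat \<times> nat) \<times> bool"
  obtain u i fx w j fy where xy: "x = ((u, i), fx)" "y = ((w, j), fy)"
    by (metis surj_pair)
  show "state_matrix (\<lambda>_. 0) y x = - state_matrix (\<lambda>_. 0) x y"
    by (rule state_matrix_skew)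
  \<comment> \<open>For constant \<open>\<alpha>\<close> every test for equality succeeds and the
    test for an excess of 1 fails, so \<open>half\<close> counts arrows without sign.\<close>
  have half: "half (\<lambda>_. 0) p q = int (arr (Q \<boxtimes> A_infinity) p q)" for p q
  proof -
    obtain u i w j where "p = (u, i)" "q = (w, j)" by fastforce
    then show ?thesis
      by (simp add: half_def triangular_product_def A_infinity_def) auto
  qed
  \<comment> \<open>The state matrix is the difference of the two arrow counts; its positive part
    gives back each count because one of them is 0.\<close>
  have no_2_cycle: "arr (Q \<boxtimes> A_infinity) p q = 0 \<or> arr (Q \<boxtimes> A_infinity) q p = 0" for p q
  proof -
    obtain u i w j where "p = (u, i)" "q = (w, j)" by fastforce
    then show ?thesis
      using arr_no_2_path[of u w u]
      by (cases "u = w"; cases "arr Q u w = 0") (auto simp: triangular_product_def A_infinity_def)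
  qed
  consider "\<not> fx" "\<not> fy" | "\<not> fx" "fy" | "fx" by blast
  then show "arr (framed (Q \<boxtimes> A_infinity)) x y = nat (state_matrix (\<lambda>_. 0) x y)"
  proof cases
    case 1
    then show ?thesis
      using no_2_cycle[of "(u, i)" "(w, j)"]
      by (auto simp: xy state_matrix_def half framed_def)
  next
    case 2
    then show ?thesis
      by (auto simp: xy state_matrix_def c_vector_def framed_def triangular_product_def A_infinity_def)
  next
    case 3
    then show ?thesis
      by (auto simp: xy state_matrix_def c_vector_def framed_def)
  qed
qed

text \<open>No diagonal arrow meets \<open>(v, k)\<close>. If \<open>v\<close> is a sink with a
  neighbour, column \<open>k\<close> is half way through. If \<open>v\<close> is a source, a
  diagonal from the left would need columns \<open>k - 1\<close> and \<open>k\<close> level, and one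
  from the right would need column \<open>k\<close> one ahead of column \<open>k + 1\<close>;
  admissibility says the opposite.\<close>

lemma state_matrix_into:
  assumes "admissible \<alpha> (v, k)"
  shows "state_matrix \<alpha> (mut (u, i)) (mut (v, k)) =
    of_bool (u = v \<and> (i = k + 1 \<or> 1 \<le> i \<and> i + 1 = k)) - of_bool (i = k) * int (adj v u)"
proof (cases "u = v")
  case True
  show ?thesis
    using admissibleD(1,2)[OF assms] admissibleD(3,4)[OF assms, of v]
    by (auto simp: True state_matrix_def half_def adj_def)
next
  case False
  show ?thesis
  proof (cases "adj v u = 0")
    case True
    then show ?thesis
      using False by (simp add: adj_def state_matrix_def half_def)
  next
    case adj: False
    then have V: "u \<in> verts Q" "v \<in> verts Q" using adj_verts[OF adj] by auto
    have k: "1 \<le> k" "\<alpha> (u, Suc k) = \<alpha> (v, k)" "\<alpha> (v, Suc k) = \<alpha> (v, k)"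
      using admissibleD[OF assms] V by auto
    have arrow: "arr Q v u \<noteq> 0 \<and> arr Q u v = 0 \<and> \<alpha> (u, k) = \<alpha> (v, k) \<or>
        arr Q u v \<noteq> 0 \<and> arr Q v u = 0 \<and> \<alpha> (u, k) = Suc (\<alpha> (v, k))"
      using admissibleD(5,6)[OF assms, of u] adj arr_no_2_path[of u v u]
      by (cases "arr Q v u = 0") (auto simp: adj_def)
    consider "i = k" | "i = Suc k" | "1 \<le> i" "k = Suc i" | "i = 0"
      | "i \<noteq> k" "i \<noteq> Suc k" "k \<noteq> Suc i"
      by linarith
    then show ?thesis
    proof cases
      case 3
      then have "\<alpha> (u, i) = Suc (\<alpha> (v, k))" "\<alpha> (v, i) = Suc (\<alpha> (v, k))"
        using admissibleD(4)[OF assms] V by auto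
      with arrow show ?thesis
        by (elim disjE) (use 3 False k in \<open>simp_all add: adj_def state_matrix_def half_def\<close>)
    qed (use arrow in \<open>elim disjE conjE;
        use False k in \<open>simp add: adj_def state_matrix_def half_def\<close>\<close>)+
  qed
qed

text \<open>An admissible vertex falls in the first branch of \<open>c_vector\<close>. All its
  frozen entries are therefore nonnegative, which is greenness.\<close>

lemma state_matrix_frozen:
  assumes "admissible \<alpha> (v, k)"
  shows "state_matrix \<alpha> (mut (v, k)) (frz (w, j)) =
    of_bool (w = v \<and> \<alpha> (v, k) + 1 \<le> j \<and> j \<le> \<alpha> (v, k) + k)"
proof -
  have "v \<in> verts Q" "1 \<le> k" "\<alpha> (v, Suc k) = \<alpha> (v, k)" "k = 1 \<or> \<alpha> (v, k - 1) \<noteq> \<alpha> (v, k)"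
    using admissibleD(1-3)[OF assms] admissibleD(4)[OF assms, of v "k - 1"]
    by (cases "k = 1"; auto)+
  then show ?thesis
    by (cases "w = v") (simp_all add: state_matrix_def c_vector_def Let_def)
qed

lemma state_matrix_out:
  assumes "admissible \<alpha> (v, k)"
  shows "state_matrix \<alpha> (mut (v, k)) (mut (u, i)) =
    of_bool (i = k) * int (adj v u) - of_bool (u = v \<and> (i = k + 1 \<or> 1 \<le> i \<and> i + 1 = k))"
  using state_matrix_into[OF assms, of u i] state_matrix_skew[of \<alpha> "mut (v, k)" "mut (u, i)"]
  by simp

section \<open>Change of the state matrix under one mutation\<close>

lemma bump_same: "bump \<alpha> p p = Suc (\<alpha> p)"
  by (simp add: bump_def)

lemma bump_other: "q \<noteq> p \<Longrightarrow> bump \<alpha> p q = \<alpha> q"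
  by (simp add: bump_def)

text \<open>Again no diagonal meets \<open>(v, k)\<close>, with the two reasons interchanged: now a
  source \<open>v\<close> leaves the column half way through, and for a sink \<open>v\<close> the
  shifts of the neighbouring columns exclude diagonals.\<close>

lemma state_matrix_bump_out:
  assumes "admissible \<alpha> (v, k)"
  shows "state_matrix (bump \<alpha> (v, k)) (mut (v, k)) (mut (u, i)) =
    - state_matrix \<alpha> (mut (v, k)) (mut (u, i))"
proof (cases "u = v")
  case True
  consider "i = Suc k" | "1 \<le> i" "k = Suc i" | "i \<noteq> Suc k" "\<not> (1 \<le> i \<and> k = Suc i)"
    by linarith
  then show ?thesis
  proof cases
    case 1
    then show ?thesis
      using admissibleD(1,2,3)[OF assms]
      by (simp add: True state_matrix_out[OF assms] state_matrix_def half_def bump_def)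
  next
    case 2
    then show ?thesis
      using admissibleD(1,2)[OF assms] admissibleD(4)[OF assms, of v i]
      by (simp add: True state_matrix_out[OF assms] state_matrix_def half_def bump_def)
  next
    case 3
    then show ?thesis
      by (auto simp: True state_matrix_out[OF assms] state_matrix_def half_def adj_def)
  qed
next
  case False
  show ?thesis
  proof (cases "adj v u = 0")
    case True
    then show ?thesis
      using False by (simp add: adj_def state_matrix_def half_def)
  next
    case adj: False
    then have V: "u \<in> verts Q" "v \<in> verts Q" using adj_verts[OF adj] by auto
    have k: "1 \<le> k" "\<alpha> (u, Suc k) = \<alpha> (v, k)" "\<alpha> (v, Suc k) = \<alpha> (v, k)"
      using admissibleD[OF assms] V by auto
    have arrow: "arr Q u v = 0 \<and> \<alpha> (u, k) = \<alpha> (v, k) \<or>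
        arr Q v u = 0 \<and> \<alpha> (u, k) = Suc (\<alpha> (v, k))"
      using admissibleD(5,6)[OF assms, of u] adj arr_no_2_path[of u v u]
      by (cases "arr Q v u = 0") (auto simp: adj_def)
    consider "i = k" | "i = Suc k" | "1 \<le> i" "k = Suc i" | "i = 0"
      | "i \<noteq> k" "i \<noteq> Suc k" "k \<noteq> Suc i"
      by linarith
    then show ?thesis
    proof cases
      case 3
      then have "\<alpha> (u, i) = Suc (\<alpha> (v, k))" "\<alpha> (v, i) = Suc (\<alpha> (v, k))"
        using admissibleD(4)[OF assms] V by auto
      with arrow show ?thesis
        by (elim disjE conjE)
          (use 3 False k in
            \<open>simp_all add: state_matrix_out[OF assms] adj_def state_matrix_def half_def bump_def\<close>)
    qed (use arrow in \<open>elim disjE conjE;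
        use False k in
          \<open>simp add: state_matrix_out[OF assms] adj_def state_matrix_def half_def bump_def\<close>\<close>)+
  qed
qed

text \<open>The correction counts the paths from \<open>(v, i)\<close> through \<open>(v, k)\<close>
  to \<open>(w, k)\<close>. If \<open>v\<close> is a sink they create diagonals; if \<open>v\<close>
  is a source they cancel the diagonals from \<open>(w, k)\<close> to \<open>(v, i)\<close>.\<close>

lemma state_matrix_bump_other:
  assumes "admissible \<alpha> (v, k)" "(v, i) \<noteq> (v, k)" "w \<noteq> v"
  shows "state_matrix (bump \<alpha> (v, k)) (mut (v, i)) (mut (w, k)) =
    state_matrix \<alpha> (mut (v, i)) (mut (w, k)) +
    of_bool (i = k + 1 \<or> 1 \<le> i \<and> i + 1 = k) * int (adj v w)"
proof (cases "adj v w = 0")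
  case True
  then show ?thesis
    using assms by (simp add: adj_def state_matrix_def half_def)
next
  case adj: False
  then have V: "w \<in> verts Q" "v \<in> verts Q" using adj_verts[OF adj] by auto
  have k: "1 \<le> k" "\<alpha> (w, Suc k) = \<alpha> (v, k)" "\<alpha> (v, Suc k) = \<alpha> (v, k)"
    using admissibleD[OF assms(1)] V by auto
  have arrow: "arr Q w v = 0 \<and> \<alpha> (w, k) = \<alpha> (v, k) \<or>
      arr Q v w = 0 \<and> \<alpha> (w, k) = Suc (\<alpha> (v, k))"
    using admissibleD(5,6)[OF assms(1), of w] adj arr_no_2_path[of w v w]
    by (cases "arr Q v w = 0") (auto simp: adj_def)
  consider "i = Suc k" | "1 \<le> i" "k = Suc i" | "i = 0" | "i \<noteq> k" "i \<noteq> Suc k" "k \<noteq> Suc i"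
    using assms(2) by fastforce
  then show ?thesis
  proof cases
    case 2
    then have "\<alpha> (w, i) = Suc (\<alpha> (v, k))" "\<alpha> (v, i) = Suc (\<alpha> (v, k))"
      using admissibleD(4)[OF assms(1)] V by auto
    with arrow show ?thesis
      by (elim disjE conjE)
        (use 2 assms(3) k in \<open>simp_all add: adj_def state_matrix_def half_def bump_def\<close>)
  qed (use arrow in \<open>elim disjE conjE;
      use assms(3) k in \<open>simp add: adj_def state_matrix_def half_def bump_def\<close>\<close>)+
qed

lemma c_vector_bump_same:
  assumes "admissible \<alpha> (v, k)"
  shows "c_vector (bump \<alpha> (v, k)) (v, k) f = - c_vector \<alpha> (v, k) f"
proof -
  obtain w j where f: "f = (w, j)" by fastforce
  have "c_vector \<alpha> (v, k) f = of_bool (w = v \<and> \<alpha> (v, k) + 1 \<le> j \<and> j \<le> \<alpha> (v, k) + k)"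
    using state_matrix_frozen[OF assms, of w j] by (simp add: state_matrix_def f)
  moreover have "v \<in> verts Q" "1 \<le> k" "\<alpha> (v, Suc k) = \<alpha> (v, k)"
    "k = 1 \<or> \<alpha> (v, k - 1) = Suc (\<alpha> (v, k))"
    using admissibleD(1-3)[OF assms] admissibleD(4)[OF assms, of v "k - 1"]
    by (cases "k = 1"; auto)+
  ultimately show ?thesis
    by (cases "w = v"; cases "k = 1") (auto simp: f c_vector_def bump_def Let_def)
qed

lemma c_vector_bump_other:
  assumes "admissible \<alpha> (v, k)" "x \<noteq> (v, k)"
  shows "c_vector (bump \<alpha> (v, k)) x f = c_vector \<alpha> x f +
    of_bool (x = (v, k + 1) \<or> x = (v, k - 1) \<and> 2 \<le> k) * c_vector \<alpha> (v, k) f"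
proof -
  obtain u i w j where x: "x = (u, i)" and f: "f = (w, j)" by fastforce
  have cp: "c_vector \<alpha> (v, k) f = of_bool (w = v \<and> \<alpha> (v, k) + 1 \<le> j \<and> j \<le> \<alpha> (v, k) + k)"
    using state_matrix_frozen[OF assms(1), of w j] by (simp add: state_matrix_def f)
  have vk: "v \<in> verts Q" "1 \<le> k" "\<alpha> (v, Suc k) = \<alpha> (v, k)"
    using admissibleD(1-3)[OF assms(1)] by auto
  consider "x = (v, Suc k)" | l where "k = Suc l" "1 \<le> l" "x = (v, l)"
    | "u \<noteq> v \<or> i \<noteq> Suc k \<and> Suc i \<noteq> k \<or> i = 0"
    unfolding x by (cases "u = v"; cases "i = Suc k"; cases "Suc i = k"; cases "i = 0") auto
  then show ?thesis
  proof cases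
    case 1
    then show ?thesis
      unfolding cp using vk
      by (auto simp: f c_vector_def bump_def Let_def)
  next
    case (2 l)
    define a where "a = \<alpha> (v, k)"
    have "\<alpha> (v, l) = Suc a" "\<alpha> (v, Suc l) = a"
      using 2 admissibleD(4)[OF assms(1)] \<open>v \<in> verts Q\<close> by (auto simp: a_def)
    note vals = this
    \<comment> \<open>\<open>d\<close> selects the branch of \<open>c_vector\<close> at
      \<open>(v, l)\<close>, whose right neighbour is \<open>(v, k)\<close>. In both branches adding
      the interval \<open>[a + 1, a + k]\<close> makes a negative vector positive.\<close>
    define d where "d \<longleftrightarrow> l = 1 \<or> \<alpha> (v, l - 1) \<noteq> Suc a"
    have "l - 1 \<noteq> Suc l" by simp
    then have "c_vector (bump \<alpha> (v, k)) x f = (if w = v then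
        if d then of_bool (Suc a + 1 \<le> j \<and> j \<le> Suc a + l) else of_bool (j = Suc a + l) else 0)"
      using 2 vals \<open>v \<in> verts Q\<close> by (cases "w = v") (simp_all add: f c_vector_def bump_def d_def Let_def)
    moreover have "c_vector \<alpha> x f = (if w = v then
        if d then - of_bool (j = Suc a) else - of_bool (Suc a \<le> j \<and> j + 1 \<le> Suc a + l) else 0)"
      using 2 vals \<open>v \<in> verts Q\<close> by (cases "w = v") (simp_all add: f c_vector_def d_def Let_def)
    moreover have "x = (v, k - 1) \<and> 2 \<le> k" using 2 by auto
    moreover have "of_bool (Suc a + 1 \<le> j \<and> j \<le> Suc a + l) =
        of_bool (a + 1 \<le> j \<and> j \<le> a + k) - (of_bool (j = Suc a) :: int)"
      using \<open>k = Suc l\<close> by auto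
    moreover have "of_bool (j = Suc a + l) = of_bool (a + 1 \<le> j \<and> j \<le> a + k) -
        (of_bool (Suc a \<le> j \<and> j + 1 \<le> Suc a + l) :: int)"
      using \<open>k = Suc l\<close> by auto
    ultimately show ?thesis
      unfolding cp a_def[symmetric]
      by (cases "w = v"; cases d; simp only: simp_thms if_True if_False of_bool_eq; linarith)
  next
    case 3
    have "c_vector (bump \<alpha> (v, k)) x f = c_vector \<alpha> x f"
    proof (cases "1 \<le> i")
      case True
      then have "(u, i) \<noteq> (v, k)" "(u, i + 1) \<noteq> (v, k)" "i = 1 \<or> (u, i - 1) \<noteq> (v, k)"
        using 3 assms(2) by (auto simp: x)
      then show ?thesis
        by (cases "w = u"; cases "i = 1") (simp_all add: x f c_vector_def bump_other Let_def)
    qed (simp add: x f c_vector_def)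
    moreover have "\<not> (x = (v, k + 1) \<or> x = (v, k - 1) \<and> 2 \<le> k)"
      using 3 by (auto simp: x)
    ultimately show ?thesis
      by (simp only: of_bool_eq mult_zero_left add_0_right)
  qed
qed

text \<open>\<open>half\<close> reads \<open>\<alpha>\<close> only at the four corners of the
  rectangle spanned by the two vertices, and the hypotheses keep all four away from
  \<open>(v, k)\<close>.\<close>

lemma state_matrix_bump_unaffected:
  assumes "(u, i) \<noteq> (v, k)" "(w, j) \<noteq> (v, k)" "u = v \<longrightarrow> w = v \<or> j \<noteq> k" "w = v \<longrightarrow> u = v \<or> i \<noteq> k"
  shows "state_matrix (bump \<alpha> (v, k)) (mut (u, i)) (mut (w, j)) =
    state_matrix \<alpha> (mut (u, i)) (mut (w, j))"
proof -
  have "bump \<alpha> (v, k) (u, i) = \<alpha> (u, i)" "bump \<alpha> (v, k) (u, j) = \<alpha> (u, j)"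
    "bump \<alpha> (v, k) (w, i) = \<alpha> (w, i)" "bump \<alpha> (v, k) (w, j) = \<alpha> (w, j)"
    using assms by (auto intro!: bump_other)
  note agree = this
  show ?thesis
    unfolding state_matrix_def half_def prod.case agree by (simp only: not_False_eq_True simp_thms if_True)
qed

text \<open>Arrows into \<open>(v, k)\<close> come from its row, arrows out of it go to its column
  and to frozen vertices. Hence the only new paths are row to column and row to frozen, handled by
  \<open>mm\<close> and \<open>mf\<close>.\<close>

lemma mutate_state_matrix:
  assumes adm: "admissible \<alpha> (v, k)"
  shows "mutate_matrix (state_matrix \<alpha>) (mut (v, k)) = state_matrix (bump \<alpha> (v, k))"
proof (intro ext)
  fix x y :: "(nat \<times> nat) \<times> bool"
  let ?b = "state_matrix \<alpha>" and ?b' = "state_matrix (bump \<alpha> (v, k))" and ?p = "mut (v, k)"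
  define I where "I u i = (of_bool (u = v \<and> (i = k + 1 \<or> 1 \<le> i \<and> i + 1 = k)) :: int)" for u i
  define O' where "O' u i = of_bool (i = k) * int (adj v u)" for u i
  have disj: "I u i = 0 \<or> O' u i = 0" for u i
    by (auto simp: I_def O'_def)
  have pos: "0 \<le> I u i" "0 \<le> O' u i" for u i
    by (auto simp: I_def O'_def)
  have into: "?b (mut (u, i)) ?p = I u i - O' u i" and out: "?b ?p (mut (u, i)) = O' u i - I u i" for u i
    using state_matrix_into[OF adm] state_matrix_out[OF adm] by (auto simp: I_def O'_def)
  have max_into: "max 0 (?b (mut (u, i)) ?p) = I u i" and max_out: "max 0 (?b ?p (mut (u, i))) = O' u i" for u i
    using disj[of u i] pos[of u i] unfolding into out by auto
  have frozen: "0 \<le> ?b ?p (frz f)" for f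
    using state_matrix_frozen[OF adm] by (cases f) simp
  have max_frozen: "max 0 (?b ?p (frz f)) = c_vector \<alpha> (v, k) f" "max 0 (?b (frz f) ?p) = 0" for f
    using frozen[of f] by (simp_all add: state_matrix_def)
  have out': "?b' ?p z = - ?b ?p z" for z
    using state_matrix_bump_out[OF adm] c_vector_bump_same[OF adm]
    by (cases z) (auto simp: state_matrix_def)
  have mm: "?b' (mut (u, i)) (mut (w, j)) = ?b (mut (u, i)) (mut (w, j)) + (I u i * O' w j - I w j * O' u i)"
    if "(u, i) \<noteq> (v, k)" "(w, j) \<noteq> (v, k)" for u i w j
  proof -
    consider "u = v" "w \<noteq> v" "j = k" | "w = v" "u \<noteq> v" "i = k"
      | "u = v \<longrightarrow> w = v \<or> j \<noteq> k" "w = v \<longrightarrow> u = v \<or> i \<noteq> k" by blast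
    then show ?thesis
    proof cases
      case 1
      then show ?thesis
        using state_matrix_bump_other[OF adm, of i w] that by (simp add: I_def O'_def)
    next
      case 2
      then show ?thesis
        using state_matrix_bump_other[OF adm, of j u] that
          state_matrix_skew[of _ "mut (u, i)" "mut (w, j)"] by (simp add: I_def O'_def)
    next
      case 3
      \<comment> \<open>A nonzero product would be a path from row to column, and \<open>adj\<close>
        has no loops; this is what the first two cases cover.\<close>
      have zero: "I u i * O' w j = 0" "I w j * O' u i = 0"
        using 3 that by (auto simp: I_def O'_def adj_def)
      show ?thesis
        unfolding zero using state_matrix_bump_unaffected[OF that 3] by simp
    qed
  qed
  have mf: "?b' (mut (u, i)) (frz f) = ?b (mut (u, i)) (frz f) + I u i * c_vector \<alpha> (v, k) f"
    if "(u, i) \<noteq> (v, k)" for u i f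
    using c_vector_bump_other[OF adm that, of f] admissibleD(2)[OF adm]
    by (auto simp: state_matrix_def I_def)
  obtain u i fx w j fy where xy: "x = ((u, i), fx)" "y = ((w, j), fy)"
    by (metis surj_pair)
  consider "x = ?p" | "y = ?p" | "x \<noteq> ?p" "y \<noteq> ?p" by blast
  then show "mutate_matrix ?b ?p x y = ?b' x y"
  proof cases
    case 1
    then show ?thesis using out' by (simp add: mutate_matrix_def)
  next
    case 2
    then show ?thesis
      using out'[of x] state_matrix_skew[of _ x ?p] by (simp add: mutate_matrix_def)
  next
    case 3
    then have step: "mutate_matrix ?b ?p x y =
        ?b x y + (max 0 (?b x ?p) * max 0 (?b ?p y) - max 0 (?b y ?p) * max 0 (?b ?p x))"
      by (simp add: mutate_matrix_def)
    consider "fx = False" "fy = False" | "fx = False" "fy = True" | "fx = True" "fy = False"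
      | "fx = True" "fy = True"
      by (metis (full_types))
    then show ?thesis
    proof cases
      case 1
      then show ?thesis
        using mm[of u i w j] 3 unfolding step by (simp add: xy max_into max_out)
    next
      case 2
      then show ?thesis
        using mf[of u i "(w, j)"] 3 unfolding step by (simp add: xy max_into max_frozen)
    next
      case 3
      then show ?thesis
        using mf[of w j "(u, i)"] \<open>y \<noteq> ?p\<close>
          state_matrix_skew[of _ "frz (u, i)" "mut (w, j)"]
        unfolding step by (simp add: xy max_into max_frozen)
    next
      case 4
      then show ?thesis
        unfolding step by (simp add: xy max_frozen) (simp add: state_matrix_def)
    qed
  qed
qed

end

section \<open>Products over arrows and monomials of g-vectors\<close>

lemma prod_pow_support:
  assumes "finite T" "\<And>w. n w \<noteq> 0 \<Longrightarrow> w \<in> T"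
  shows "(\<Prod>w | n w \<noteq> 0. f w ^ n w) = (\<Prod>w \<in> T. (f w :: 'a::comm_monoid_mult) ^ n w)"
  by (rule prod.mono_neutral_left) (use assms in auto)

text \<open>The monomial with exponent \<open>e p\<close>; it lets the telescoping products below
  run through column 0.\<close>

definition xhat :: "nat \<times> nat \<Rightarrow> (nat \<times> nat) ratfun" where
  "xhat p = (if snd p = 0 then 1 else indet p)"

lemma xhat_nonzero [simp]: "xhat p \<noteq> 0"
  by (simp add: xhat_def positive_nonzero[OF positive_indet])

lemma monomial_x_e_diff:
  assumes "1 \<le> b"
  shows "monomial_x (e (v, a + b) - e (v, a)) = xhat (v, a + b) / xhat (v, a)"
proof (cases "a = 0")
  case True
  then show ?thesis
    using assms by (simp add: e_def xhat_def monomial_x_def)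
next
  case False
  let ?p = "(v, a + b)" and ?q = "(v, a)"
  let ?g = "Poly_Mapping.single ?p (1::int) - Poly_Mapping.single ?q 1"
  have "Poly_Mapping.keys ?g = {?p, ?q}"
    using assms by (auto simp: in_keys_iff lookup_minus lookup_single when_def split: if_splits)
  then have "monomial_x ?g = indet ?p * inverse (indet ?q)"
    using assms by (simp add: monomial_x_def lookup_minus lookup_single power_int_minus)
  then show ?thesis
    using False assms by (simp add: e_def xhat_def divide_inverse)
qed

section \<open>Admissible sequences and their exchange relations\<close>

context bipartite_quiver
begin

primrec admissible_list :: "(nat \<times> nat \<Rightarrow> nat) \<Rightarrow> (nat \<times> nat) list \<Rightarrow> bool" where
  "admissible_list \<alpha> [] \<longleftrightarrow> True"
| "admissible_list \<alpha> (p # S) \<longleftrightarrow> admissible \<alpha> p \<and> admissible_list (bump \<alpha> p) S"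

lemma admissible_list_append:
  "admissible_list \<alpha> (S @ S') \<longleftrightarrow> admissible_list \<alpha> S \<and> admissible_list (foldl bump \<alpha> S) S'"
  by (induction S arbitrary: \<alpha>) auto

lemma admissible_list_nth:
  assumes "admissible_list \<alpha> S" "j < length S"
  shows "admissible_list \<alpha> (take j S)" "admissible (foldl bump \<alpha> (take j S)) (S ! j)"
  using assms id_take_nth_drop[OF assms(2)] admissible_list_append[of \<alpha> "take j S" "S ! j # drop (Suc j) S"]
  by auto

lemma represents_mutate_list:
  assumes "admissible_list \<alpha> S" "represents (state_matrix \<alpha>) R"
  shows "represents (state_matrix (foldl bump \<alpha> S)) (mutate_list R (map mut S))"
  using assms
proof (induction S arbitrary: \<alpha> R)
  case Nil
  then show ?case by (simp add: mutate_list_def)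
next
  case (Cons p S)
  have "represents (state_matrix (bump \<alpha> p)) (mutate R (mut p))"
    using Cons.prems represents_mutate[of "state_matrix \<alpha>" R "mut p"] mutate_state_matrix
    by (cases p) auto
  with Cons show ?case by (simp add: mutate_list_def)
qed

abbreviation state_after :: "(nat \<times> nat) list \<Rightarrow> nat \<times> nat \<Rightarrow> nat" where
  "state_after S \<equiv> foldl bump (\<lambda>_. 0) S"

abbreviation framed_after :: "(nat \<times> nat) list \<Rightarrow> ((nat \<times> nat) \<times> bool) quiver" where
  "framed_after S \<equiv> mutate_list (framed (Q \<boxtimes> A_infinity)) (map mut S)"

lemma represents_framed_after:
  "admissible_list (\<lambda>_. 0) S \<Longrightarrow> represents (state_matrix (state_after S)) (framed_after S)"
  by (rule represents_mutate_list[OF _ state_matrix_initial])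

context
  fixes \<alpha> R v k
  assumes adm: "admissible \<alpha> (v, k)" and repr: "represents (state_matrix \<alpha>) R"
begin

lemma arr_admissible:
  "arr R (mut (u, i)) (mut (v, k)) = of_bool (u = v \<and> (i = k + 1 \<or> 1 \<le> i \<and> i + 1 = k))"
  "arr R (mut (v, k)) (mut (u, i)) = of_bool (i = k) * adj v u"
  "arr R (frz f) (mut (v, k)) = 0"
  "arr R (mut (v, k)) (frz (w, j)) = of_bool (w = v \<and> \<alpha> (v, k) + 1 \<le> j \<and> j \<le> \<alpha> (v, k) + k)"
proof -
  have arr: "arr R x y = nat (state_matrix \<alpha> x y)" for x y
    using repr unfolding represents_def by blast
  show "arr R (mut (u, i)) (mut (v, k)) = of_bool (u = v \<and> (i = k + 1 \<or> 1 \<le> i \<and> i + 1 = k))"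
    unfolding arr state_matrix_into[OF adm] by (auto simp: adj_def)
  show "arr R (mut (v, k)) (mut (u, i)) = of_bool (i = k) * adj v u"
    unfolding arr state_matrix_out[OF adm] by auto
  show "arr R (frz f) (mut (v, k)) = 0"
    unfolding arr state_matrix_skew[of _ "frz f"]
    using state_matrix_frozen[OF adm] by (cases f) simp
  show "arr R (mut (v, k)) (frz (w, j)) =
      of_bool (w = v \<and> \<alpha> (v, k) + 1 \<le> j \<and> j \<le> \<alpha> (v, k) + k)"
    unfolding arr state_matrix_frozen[OF adm] by simp
qed

text \<open>The exponent \<open>of_bool (2 \<le> k)\<close> removes the factor at column 0 when
  \<open>k = 1\<close>.\<close>

lemma prod_in:
  fixes X :: "(nat \<times> nat) \<times> bool \<Rightarrow> 'a::comm_monoid_mult"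
  shows "(\<Prod>x | arr R x (mut (v, k)) \<noteq> 0. X x ^ arr R x (mut (v, k))) =
    X (mut (v, k + 1)) * X (mut (v, k - 1)) ^ of_bool (2 \<le> k)"
proof -
  let ?T = "{mut (v, k + 1), mut (v, k - 1)}"
  have "x \<in> ?T" if "arr R x (mut (v, k)) \<noteq> 0" for x
    using that by (cases x; cases "snd x") (auto simp: arr_admissible split: if_splits)
  then have "(\<Prod>x | arr R x (mut (v, k)) \<noteq> 0. X x ^ arr R x (mut (v, k))) =
      (\<Prod>x \<in> ?T. X x ^ arr R x (mut (v, k)))"
    by (intro prod_pow_support) auto
  also have "\<dots> = X (mut (v, k + 1)) * X (mut (v, k - 1)) ^ of_bool (2 \<le> k)"
    using admissibleD(2)[OF adm] by (auto simp: arr_admissible)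
  finally show ?thesis .
qed

lemma prod_out:
  fixes X :: "(nat \<times> nat) \<times> bool \<Rightarrow> 'a::comm_monoid_mult"
  shows "(\<Prod>x | arr R (mut (v, k)) x \<noteq> 0. X x ^ arr R (mut (v, k)) x) =
    (\<Prod>u | adj v u \<noteq> 0. X (mut (u, k)) ^ adj v u) *
    (\<Prod>j \<in> {\<alpha> (v, k) + 1..\<alpha> (v, k) + k}. X (frz (v, j)))"
proof -
  let ?A = "(\<lambda>u. mut (u, k)) ` {u. adj v u \<noteq> 0}"
  let ?B = "(\<lambda>j. frz (v, j)) ` {\<alpha> (v, k) + 1..\<alpha> (v, k) + k}"
  have "x \<in> ?A \<union> ?B" if "arr R (mut (v, k)) x \<noteq> 0" for x
    using that by (cases x; cases "snd x") (auto simp: arr_admissible split: if_splits)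
  then have "(\<Prod>x | arr R (mut (v, k)) x \<noteq> 0. X x ^ arr R (mut (v, k)) x) =
      (\<Prod>x \<in> ?A \<union> ?B. X x ^ arr R (mut (v, k)) x)"
    using finite_adj by (intro prod_pow_support) auto
  also have "\<dots> = (\<Prod>x \<in> ?A. X x ^ arr R (mut (v, k)) x) * (\<Prod>x \<in> ?B. X x ^ arr R (mut (v, k)) x)"
    using finite_adj by (intro prod.union_disjoint) auto
  also have "(\<Prod>x \<in> ?A. X x ^ arr R (mut (v, k)) x) = (\<Prod>u | adj v u \<noteq> 0. X (mut (u, k)) ^ adj v u)"
    by (subst prod.reindex) (auto simp: inj_on_def arr_admissible)
  also have "(\<Prod>x \<in> ?B. X x ^ arr R (mut (v, k)) x) =
      (\<Prod>j \<in> {\<alpha> (v, k) + 1..\<alpha> (v, k) + k}. X (frz (v, j)))"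
    by (subst prod.reindex) (auto simp: inj_on_def arr_admissible)
  finally show ?thesis .
qed

lemma prod_unframed:
  fixes z :: "nat \<times> nat \<Rightarrow> 'a::comm_monoid_mult"
  assumes "\<And>x y. arr R' x y = arr R (mut x) (mut y)"
  shows "(\<Prod>x | arr R' x (v, k) \<noteq> 0. z x ^ arr R' x (v, k)) =
      z (v, k + 1) * z (v, k - 1) ^ of_bool (2 \<le> k)"
    "(\<Prod>x | arr R' (v, k) x \<noteq> 0. z x ^ arr R' (v, k) x) =
      (\<Prod>u | adj v u \<noteq> 0. z (u, k) ^ adj v u)"
proof -
  have "(\<Prod>x | arr R' x (v, k) \<noteq> 0. z x ^ arr R' x (v, k)) =
      (\<Prod>x \<in> {(v, k + 1), (v, k - 1)}. z x ^ arr R' x (v, k))"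
    by (intro prod_pow_support) (auto simp: assms arr_admissible split: if_splits)
  then show "(\<Prod>x | arr R' x (v, k) \<noteq> 0. z x ^ arr R' x (v, k)) =
      z (v, k + 1) * z (v, k - 1) ^ of_bool (2 \<le> k)"
    using admissibleD(2)[OF adm] by (auto simp: assms arr_admissible)
  have "(\<Prod>x | arr R' (v, k) x \<noteq> 0. z x ^ arr R' (v, k) x) =
      (\<Prod>x \<in> (\<lambda>u. (u, k)) ` {u. adj v u \<noteq> 0}. z x ^ arr R' (v, k) x)"
    using finite_adj by (intro prod_pow_support) (auto simp: assms arr_admissible split: if_splits)
  then show "(\<Prod>x | arr R' (v, k) x \<noteq> 0. z x ^ arr R' (v, k) x) =
      (\<Prod>u | adj v u \<noteq> 0. z (u, k) ^ adj v u)"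
    by (simp add: prod.reindex inj_on_def assms arr_admissible)
qed

end

lemma green_sequence_admissible:
  assumes "admissible_list (\<lambda>_. 0) S"
  shows "green_sequence (Q \<boxtimes> A_infinity) S"
  unfolding green_sequence_def
proof (intro allI impI conjI)
  fix j assume j: "j < length S"
  obtain v k where p: "S ! j = (v, k)" by fastforce
  note adm = admissible_list_nth[OF assms j]
  show "S ! j \<in> verts (Q \<boxtimes> A_infinity)"
    using admissibleD(1,2)[OF adm(2)[unfolded p]]
    by (simp add: p triangular_product_def A_infinity_def)
  show "is_green (framed_after (take j S)) (S ! j)"
    using arr_admissible(3)[OF adm(2)[unfolded p] represents_framed_after[OF adm(1)]]
    by (simp add: p is_green_def)
qed


section \<open>The g-vectors\<close>

lemma prod_star:
  fixes f :: "nat \<times> nat \<Rightarrow> 'a::comm_monoid_mult"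
  assumes "\<And>w. n w \<noteq> 0 \<Longrightarrow> w = (v, i) \<or> (\<exists>u. adj v u \<noteq> 0 \<and> w = (u, l))"
  shows "(\<Prod>w | n w \<noteq> 0. f w ^ n w) =
    f (v, i) ^ n (v, i) * (\<Prod>u | adj v u \<noteq> 0. f (u, l) ^ n (u, l))"
proof -
  have "(\<Prod>w | n w \<noteq> 0. f w ^ n w) =
      (\<Prod>w \<in> insert (v, i) ((\<lambda>u. (u, l)) ` {u. adj v u \<noteq> 0}). f w ^ n w)"
    using assms finite_adj by (intro prod_pow_support) auto
  also have "\<dots> = f (v, i) ^ n (v, i) * (\<Prod>u | adj v u \<noteq> 0. f (u, l) ^ n (u, l))"
    using finite_adj by (subst prod.insert) (auto simp: prod.reindex inj_on_def adj_def)
  finally show ?thesis .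
qed

text \<open>The arrows at \<open>(v, j + 1)\<close> are paired into quotients that telescope over
  \<open>j\<close>. Diagonals enter a source from column \<open>j\<close> and leave a sink for
  column \<open>j + 2\<close>.\<close>

lemma y_var_eq:
  assumes v: "v \<in> verts Q"
  shows "y_var (Q \<boxtimes> A_infinity) (v, Suc j) = xhat (v, j) / xhat (v, j + 2) *
    (\<Prod>u | adj v u \<noteq> 0. (xhat (u, j + (if is_source Q v then 1 else 2)) /
                       xhat (u, j + (if is_source Q v then 0 else 1))) ^ adj v u)"
proof (cases "is_source Q v")
  case True
  have noin: "arr Q u v = 0" for u
    using True by (simp add: is_source_def)
  have adj: "adj v u = arr Q v u" for u
    using noin by (simp add: adj_def)
  let ?R = "Q \<boxtimes> A_infinity"
  have arr: "arr ?R (v, Suc j) (u, i) =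
      of_bool (i = Suc j) * adj v u + of_bool (u = v \<and> 1 \<le> i \<and> i = j)"
    "arr ?R (u, i) (v, Suc j) =
      of_bool (u = v \<and> i = j + 2) + of_bool (1 \<le> i \<and> i = j) * adj v u" for u i
    using noin arr_verts[of v u] v
    by (auto simp: triangular_product_def A_infinity_def adj)
  have "(\<Prod>w | arr ?R (v, Suc j) w \<noteq> 0. indet w ^ arr ?R (v, Suc j) w) =
      xhat (v, j) * (\<Prod>u | adj v u \<noteq> 0. xhat (u, Suc j) ^ adj v u)"
    by (subst prod_star[of _ v j "Suc j"]) (auto simp: arr xhat_def split: if_splits)
  moreover have "(\<Prod>w | arr ?R w (v, Suc j) \<noteq> 0. indet w ^ arr ?R w (v, Suc j)) =
      xhat (v, j + 2) * (\<Prod>u | adj v u \<noteq> 0. xhat (u, j) ^ adj v u)"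
    by (subst prod_star[of _ v "j + 2" j]) (auto simp: arr xhat_def split: if_splits)
  ultimately show ?thesis
    using True by (simp add: y_var_def power_divide prod_dividef)
next
  case False
  have noout: "arr Q v u = 0" for u
    using False source_or_sink[OF v] by (simp add: is_sink_def)
  have adj: "adj v u = arr Q u v" for u
    using noout by (simp add: adj_def)
  let ?R = "Q \<boxtimes> A_infinity"
  have arr: "arr ?R (v, Suc j) (u, i) =
      of_bool (i = j + 2) * adj v u + of_bool (u = v \<and> 1 \<le> i \<and> i = j)"
    "arr ?R (u, i) (v, Suc j) =
      of_bool (u = v \<and> i = j + 2) + of_bool (i = Suc j) * adj v u" for u i
    using noout arr_verts[of u v] v
    by (auto simp: triangular_product_def A_infinity_def adj)
  have "(\<Prod>w | arr ?R (v, Suc j) w \<noteq> 0. indet w ^ arr ?R (v, Suc j) w) =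
      xhat (v, j) * (\<Prod>u | adj v u \<noteq> 0. xhat (u, j + 2) ^ adj v u)"
    by (subst prod_star[of _ v j "j + 2"]) (auto simp: arr xhat_def split: if_splits)
  moreover have "(\<Prod>w | arr ?R w (v, Suc j) \<noteq> 0. indet w ^ arr ?R w (v, Suc j)) =
      xhat (v, j + 2) * (\<Prod>u | adj v u \<noteq> 0. xhat (u, Suc j) ^ adj v u)"
    by (subst prod_star[of _ v "j + 2" "Suc j"]) (auto simp: arr xhat_def split: if_splits)
  ultimately show ?thesis
    using False by (simp add: y_var_def power_divide prod_dividef)
qed

text \<open>The quotients in row \<open>v\<close> telescope in steps of two, leaving two factors at
  each end; those in a neighbouring row telescope in steps of one. The offset \<open>s\<close> is
  the lead of the neighbours over \<open>v\<close> in an admissible state.\<close>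

lemma prod_y_var:
  assumes v: "v \<in> verts Q"
  defines "s \<equiv> if is_source Q v then 0 else 1"
  shows "(\<Prod>j \<in> {a + 1..a + k}. y_var (Q \<boxtimes> A_infinity) (v, j)) =
    xhat (v, a) * xhat (v, a + 1) / (xhat (v, a + k) * xhat (v, a + k + 1)) *
    (\<Prod>u | adj v u \<noteq> 0. (xhat (u, a + s + k) / xhat (u, a + s)) ^ adj v u)"
proof (induction k)
  case 0
  then show ?case by simp
next
  case (Suc k)
  have "y_var (Q \<boxtimes> A_infinity) (v, Suc (a + k)) = xhat (v, a + k) / xhat (v, a + k + 2) *
      (\<Prod>u | adj v u \<noteq> 0. (xhat (u, a + s + Suc k) / xhat (u, a + s + k)) ^ adj v u)"
    unfolding y_var_eq[OF v] s_def by (simp add: add_ac)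
  moreover have "(\<Prod>u | adj v u \<noteq> 0. (xhat (u, a + s + k) / xhat (u, a + s)) ^ adj v u) *
      (\<Prod>u | adj v u \<noteq> 0. (xhat (u, a + s + Suc k) / xhat (u, a + s + k)) ^ adj v u) =
      (\<Prod>u | adj v u \<noteq> 0. (xhat (u, a + s + Suc k) / xhat (u, a + s)) ^ adj v u)"
    by (simp add: prod.distrib[symmetric] power_mult_distrib[symmetric])
  moreover have "x / (p * q) * P * (p / r * D) = x / (q * r) * (P * D)" if "p \<noteq> 0"
    for x p q r P D :: "(nat \<times> nat) ratfun"
    using that by (simp add: divide_simps)
  ultimately show ?case
    using Suc.IH by simp
qed

definition g_monomial :: "(nat \<times> nat \<Rightarrow> nat) \<Rightarrow> nat \<times> nat \<Rightarrow> (nat \<times> nat) ratfun" where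
  "g_monomial \<alpha> = (\<lambda>(v, k). xhat (v, \<alpha> (v, k) + k) / xhat (v, \<alpha> (v, k)))"

lemma g_monomial_nonzero [simp]: "g_monomial \<alpha> p \<noteq> 0"
  by (simp add: g_monomial_def split: prod.splits)

text \<open>\<open>z\<close> belongs to the plain seed and \<open>X\<close> to the framed one. The
  middle clause is the equation \<open>z = x^g F(y)\<close> solved for \<open>F(y)\<close>, with
  \<open>g_monomial\<close> as \<open>x^g\<close>.\<close>

definition seed_invariant :: "(nat \<times> nat \<Rightarrow> nat) \<Rightarrow> (nat \<times> nat \<Rightarrow> (nat \<times> nat) ratfun) \<Rightarrow>
    ((nat \<times> nat) \<times> bool \<Rightarrow> ((nat \<times> nat) \<times> bool) ratfun) \<Rightarrow> bool" where
  "seed_invariant \<alpha> z X \<longleftrightarrow>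
    (let \<phi> = (\<lambda>(u, fr). if fr then y_var (Q \<boxtimes> A_infinity) u else 1) in
     (\<forall>p. positive (z p)) \<and>
     (\<forall>v \<in> verts Q. \<forall>k \<ge> 1. evaluates_to \<phi> (X (mut (v, k))) (z (v, k) / g_monomial \<alpha> (v, k))) \<and>
     (\<forall>f. evaluates_to \<phi> (X (frz f)) (y_var (Q \<boxtimes> A_infinity) f)))"

lemma seed_invariant_initial: "seed_invariant (\<lambda>_. 0) indet indet"
proof -
  let ?\<phi> = "\<lambda>(u, fr). if fr then y_var (Q \<boxtimes> A_infinity) u else 1"
  have "evaluates_to ?\<phi> (indet (mut (v, k)))
      (indet (v, k) / g_monomial (\<lambda>_. 0) (v, k))" if "1 \<le> k" for v k
    using evaluates_to_indet[of ?\<phi> "mut (v, k)"] that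
    by (simp add: g_monomial_def xhat_def positive_nonzero[OF positive_indet])
  moreover have "evaluates_to ?\<phi> (indet (frz f)) (y_var (Q \<boxtimes> A_infinity) f)" for f
    using evaluates_to_indet[of ?\<phi> "frz f"] by simp
  ultimately show ?thesis
    using positive_indet unfolding seed_invariant_def Let_def by blast
qed

text \<open>The framed numerator evaluates to \<open>z_in / M_in + z_out / M_out * y\<close>, where
  \<open>y\<close> is the product of the \<open>y\<close>-variables. Telescoping gives
  \<open>y = M_out / M_in\<close>, so both summands have denominator \<open>M_in\<close>, and
  \<open>M_in\<close> divided by the old monomial at \<open>(v, k)\<close> is the new one.\<close>

lemma seed_invariant_mutate:
  assumes adm: "admissible \<alpha> (v, k)" and repr: "represents (state_matrix \<alpha>) R"
    and R': "\<And>x y. arr R' x y = arr R (mut x) (mut y)" and inv: "seed_invariant \<alpha> z X"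
  shows "seed_invariant (bump \<alpha> (v, k)) (snd (mutate_seed (R', z) (v, k)))
    (snd (mutate_seed (R, X) (mut (v, k))))"
proof -
  define \<phi> where "\<phi> = (\<lambda>(u, fr). if fr then y_var (Q \<boxtimes> A_infinity) u else 1)"
  define a where "a = \<alpha> (v, k)"
  define s :: nat where "s = (if is_source Q v then 0 else 1)"
  define n :: nat where "n = of_bool (2 \<le> k)"
  let ?y = "\<Prod>j \<in> {a + 1..a + k}. y_var (Q \<boxtimes> A_infinity) (v, j)"
  have v: "v \<in> verts Q" and k: "1 \<le> k" and right: "\<alpha> (v, k + 1) = a"
    using admissibleD(1-3)[OF adm] by (auto simp: a_def)
  have pos: "positive (z p)" for p
    using inv unfolding seed_invariant_def Let_def by blast
  then have z_nz: "z p \<noteq> 0" for p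
    by (rule positive_nonzero)
  have ev: "evaluates_to \<phi> (X (mut (u, i))) (z (u, i) / g_monomial \<alpha> (u, i))"
    if "u \<in> verts Q" "1 \<le> i" for u i
    using inv that unfolding seed_invariant_def Let_def \<phi>_def by blast
  have ev_frz: "evaluates_to \<phi> (X (frz f)) (y_var (Q \<boxtimes> A_infinity) f)" for f
    using inv unfolding seed_invariant_def Let_def \<phi>_def by blast
  define z_in where "z_in = z (v, k + 1) * z (v, k - 1) ^ n"
  define z_out where "z_out = (\<Prod>u | adj v u \<noteq> 0. z (u, k) ^ adj v u)"
  define M_in where "M_in = g_monomial \<alpha> (v, k + 1) * g_monomial \<alpha> (v, k - 1) ^ n"
  define M_out where "M_out = (\<Prod>u | adj v u \<noteq> 0. g_monomial \<alpha> (u, k) ^ adj v u)"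
  define X_in where "X_in = X (mut (v, k + 1)) * X (mut (v, k - 1)) ^ n"
  define X_out where "X_out = (\<Prod>u | adj v u \<noteq> 0. X (mut (u, k)) ^ adj v u) *
    (\<Prod>j \<in> {a + 1..a + k}. X (frz (v, j)))"
  have z': "snd (mutate_seed (R', z) (v, k)) = z((v, k) := (z_in + z_out) / z (v, k))"
    by (simp only: mutate_seed_def prod.case snd_conv prod_unframed[OF adm repr R'] z_in_def z_out_def n_def)
  have X': "snd (mutate_seed (R, X) (mut (v, k))) =
      X(mut (v, k) := (X_in + X_out) / X (mut (v, k)))"
    by (simp only: mutate_seed_def prod.case snd_conv prod_in[OF adm repr] prod_out[OF adm repr]
        X_in_def X_out_def n_def a_def)
  have "evaluates_to \<phi> (X (mut (v, k - 1)) ^ n) ((z (v, k - 1) / g_monomial \<alpha> (v, k - 1)) ^ n)"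
  proof (cases "2 \<le> k")
    case True
    then show ?thesis by (intro evaluates_to_power ev v) auto
  qed (simp add: n_def evaluates_to_1)
  then have "evaluates_to \<phi> X_in
      (z (v, k + 1) / g_monomial \<alpha> (v, k + 1) * (z (v, k - 1) / g_monomial \<alpha> (v, k - 1)) ^ n)"
    unfolding X_in_def by (intro evaluates_to_mult ev v) auto
  then have ev_in: "evaluates_to \<phi> X_in (z_in / M_in)"
    by (simp add: z_in_def M_in_def power_divide)
  have "evaluates_to \<phi> X_out ((\<Prod>u | adj v u \<noteq> 0. (z (u, k) / g_monomial \<alpha> (u, k)) ^ adj v u) * ?y)"
    unfolding X_out_def
    by (intro evaluates_to_mult evaluates_to_prod evaluates_to_power ev ev_frz k)
      (use adj_verts in auto)
  then have ev_out: "evaluates_to \<phi> X_out (z_out / M_out * ?y)"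
    by (simp add: z_out_def M_out_def power_divide prod_dividef)
  \<comment> \<open>For \<open>k = 1\<close> the absent factor would be
    \<open>xhat (v, a + 1) / xhat (v, a + 1)\<close>, so one formula serves all
    \<open>k\<close>.\<close>
  have M_in: "M_in = xhat (v, a + k + 1) * xhat (v, a + k) / (xhat (v, a) * xhat (v, a + 1))"
  proof (cases "2 \<le> k")
    case True
    then have "\<alpha> (v, k - 1) = a + 1"
      using admissibleD(4)[OF adm v, of "k - 1"] by (auto simp: a_def)
    then show ?thesis
      using True right by (simp add: M_in_def n_def g_monomial_def add_ac)
  next
    case False
    then have "k = 1" using k by simp
    then show ?thesis
      using right by (simp add: M_in_def n_def g_monomial_def add_ac)
  qed
  have "\<alpha> (u, k) = a + s" if "adj v u \<noteq> 0" for u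
    using adm that by (simp add: admissible_def a_def s_def)
  then have M_out: "M_out = (\<Prod>u | adj v u \<noteq> 0. (xhat (u, a + s + k) / xhat (u, a + s)) ^ adj v u)"
    unfolding M_out_def g_monomial_def by (intro prod.cong) auto
  have nz: "M_in \<noteq> 0" "M_out \<noteq> 0"
    using finite_adj by (auto simp: M_in_def M_out_def)
  have y: "?y = M_out / M_in"
    unfolding prod_y_var[OF v] M_in M_out s_def by (simp add: mult_ac)
  have g: "g_monomial (bump \<alpha> (v, k)) (v, k) = M_in / g_monomial \<alpha> (v, k)"
    unfolding M_in by (simp add: g_monomial_def bump_same a_def[symmetric] add_ac)
  have "evaluates_to \<phi> ((X_in + X_out) / X (mut (v, k)))
      ((z_in / M_in + z_out / M_out * ?y) / (z (v, k) / g_monomial \<alpha> (v, k)))"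
    by (intro evaluates_to_divide evaluates_to_add ev_in ev_out ev v k) (simp add: z_nz)
  also have "(z_in / M_in + z_out / M_out * ?y) / (z (v, k) / g_monomial \<alpha> (v, k)) =
      (z_in + z_out) / z (v, k) / g_monomial (bump \<alpha> (v, k)) (v, k)"
    unfolding y g using nz z_nz by (simp add: field_simps)
  finally have new: "evaluates_to \<phi> ((X_in + X_out) / X (mut (v, k)))
      ((z_in + z_out) / z (v, k) / g_monomial (bump \<alpha> (v, k)) (v, k))" .
  have "positive (z_in + z_out)"
    unfolding z_in_def z_out_def
    by (intro positive_add positive_mult positive_power positive_prod pos)
  then have "positive ((z_in + z_out) / z (v, k))"
    by (intro positive_divide pos)
  moreover have "g_monomial (bump \<alpha> (v, k)) (u, i) = g_monomial \<alpha> (u, i)" if "(u, i) \<noteq> (v, k)" for u i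
    using that by (simp add: g_monomial_def bump_other)
  ultimately show ?thesis
    unfolding z' X' seed_invariant_def Let_def \<phi>_def[symmetric]
    using new ev ev_frz pos by auto
qed

lemma seed_invariant_mutate_list:
  assumes "admissible_list \<alpha> S" "represents (state_matrix \<alpha>) R"
    "\<And>x y. arr R' x y = arr R (mut x) (mut y)" "seed_invariant \<alpha> z X"
  shows "seed_invariant (foldl bump \<alpha> S) (snd (mutate_seed_list (R', z) S))
    (snd (mutate_seed_list (R, X) (map mut S)))"
  using assms
proof (induction S arbitrary: \<alpha> R R' z X)
  case Nil
  then show ?case by (simp add: mutate_seed_list_def)
next
  case (Cons p S)
  obtain v k where p: "p = (v, k)" by fastforce
  have adm: "admissible \<alpha> (v, k)" "admissible_list (bump \<alpha> p) S"
    using Cons.prems(1) by (auto simp: p)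
  have repr: "represents (state_matrix (bump \<alpha> p)) (mutate R (mut p))"
    using represents_mutate[OF Cons.prems(2), of "mut p"] mutate_state_matrix[OF adm(1)]
    by (simp add: p)
  have arr: "arr (mutate R' p) x y = arr (mutate R (mut p)) (mut x) (mut y)" for x y
    using Cons.prems(3) by (auto simp: mutate_def)
  have split: "mutate_seed (R', z) p = (mutate R' p, snd (mutate_seed (R', z) p))"
    "mutate_seed (R, X) (mut p) = (mutate R (mut p), snd (mutate_seed (R, X) (mut p)))"
    by (simp_all add: mutate_seed_def)
  have "seed_invariant (bump \<alpha> p) (snd (mutate_seed (R', z) p)) (snd (mutate_seed (R, X) (mut p)))"
    unfolding p by (rule seed_invariant_mutate[OF adm(1) Cons.prems(2-4)])
  from Cons.IH[OF adm(2) repr arr this, folded split] show ?case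
    by (simp add: mutate_seed_list_def)
qed

lemma is_g_vector_admissible:
  assumes "admissible_list (\<lambda>_. 0) S" "v \<in> verts Q" "1 \<le> b"
  defines "a \<equiv> state_after S (v, b)"
  shows "is_g_vector (Q \<boxtimes> A_infinity) S (v, b) (e (v, a + b) - e (v, a))"
proof -
  let ?z = "snd (mutate_seed_list (initial_seed (Q \<boxtimes> A_infinity)) S)"
  have "seed_invariant (state_after S) ?z
      (snd (mutate_seed_list (initial_seed (framed (Q \<boxtimes> A_infinity))) (map mut S)))"
    unfolding initial_seed_def
    by (rule seed_invariant_mutate_list[OF assms(1) state_matrix_initial _ seed_invariant_initial])
      (simp add: framed_def)
  then have "F_at_y (Q \<boxtimes> A_infinity) S (v, b) = ?z (v, b) / g_monomial (state_after S) (v, b)"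
    unfolding F_at_y_def seed_invariant_def Let_def using assms(2,3) by (blast intro: eval_ratfun_eqI)
  moreover have "monomial_x (e (v, a + b) - e (v, a)) = g_monomial (state_after S) (v, b)"
    using monomial_x_e_diff[OF assms(3)] by (simp add: g_monomial_def a_def)
  ultimately show ?thesis
    by (simp add: is_g_vector_def)
qed


section \<open>Lifting sink sequences\<close>

text \<open>\<open>M\<close> collects the vertices of column \<open>k\<close> already mutated and
  \<open>L\<close> those still to come; the induction moves the head of \<open>L\<close> into
  \<open>M\<close>.\<close>

lemma admissible_list_column:
  assumes "distinct L" "set L \<subseteq> verts Q" "set L \<inter> M = {}" "1 \<le> k"
    and "\<forall>u \<in> verts Q. \<beta> (u, k + 1) = a"
    and "2 \<le> k \<longrightarrow> (\<forall>u \<in> verts Q. \<beta> (u, k - 1) = a + 1)"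
    and "\<forall>u \<in> verts Q. \<beta> (u, k) = a + of_bool (u \<in> M)"
    and "\<forall>v \<in> set L. \<forall>u. adj v u \<noteq> 0 \<longrightarrow> (if is_source Q v then u \<notin> M \<union> set L else u \<in> M)"
  shows "admissible_list \<beta> (map (\<lambda>u. (u, k)) L) \<and>
    foldl bump \<beta> (map (\<lambda>u. (u, k)) L) = (\<lambda>q. \<beta> q + of_bool (snd q = k \<and> fst q \<in> set L))"
  using assms
proof (induction L arbitrary: \<beta> M)
  case Nil
  then show ?case by simp
next
  case (Cons v L)
  have "\<beta> (v, k) = a"
    using Cons.prems by auto
  moreover have "\<beta> (u, k) = a + (if is_source Q v then 0 else 1)" if "adj v u \<noteq> 0" for u
    using Cons.prems(7,8) that adj_verts[OF that] by auto
  ultimately have "admissible \<beta> (v, k)"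
    using Cons.prems(2,4,5,6) by (simp add: admissible_def)
  moreover have "admissible_list (bump \<beta> (v, k)) (map (\<lambda>u. (u, k)) L) \<and>
    foldl bump (bump \<beta> (v, k)) (map (\<lambda>u. (u, k)) L) =
      (\<lambda>q. bump \<beta> (v, k) q + of_bool (snd q = k \<and> fst q \<in> set L))"
  proof (rule Cons.IH[of "insert v M"])
    show "\<forall>u \<in> verts Q. bump \<beta> (v, k) (u, k + 1) = a"
      "2 \<le> k \<longrightarrow> (\<forall>u \<in> verts Q. bump \<beta> (v, k) (u, k - 1) = a + 1)"
      using Cons.prems(5,6) by (auto simp: bump_def)
    show "\<forall>u \<in> verts Q. bump \<beta> (v, k) (u, k) = a + of_bool (u \<in> insert v M)"
      using Cons.prems(7) \<open>\<beta> (v, k) = a\<close> by (simp add: bump_def)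
    show "\<forall>w \<in> set L. \<forall>u. adj w u \<noteq> 0 \<longrightarrow>
        (if is_source Q w then u \<notin> insert v M \<union> set L else u \<in> insert v M)"
    proof (intro ballI allI impI)
      fix w u assume "w \<in> set L" "adj w u \<noteq> 0"
      with Cons.prems(8) have "if is_source Q w then u \<notin> M \<union> set (v # L) else u \<in> M"
        by (metis list.set_intros(2))
      then show "if is_source Q w then u \<notin> insert v M \<union> set L else u \<in> insert v M"
        by (simp split: if_splits)
    qed
  qed (use Cons.prems in auto)
  moreover have "bump \<beta> (v, k) q + of_bool (snd q = k \<and> fst q \<in> set L) =
      \<beta> q + of_bool (snd q = k \<and> fst q \<in> set (v # L))" for q
    using Cons.prems(1) by (cases q) (auto simp: bump_def)
  ultimately show ?case by simp
qed

end

text \<open>The analogue of \<open>admissible_list\<close> for \<open>A_infinity\<close>. Equal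
  shifts at \<open>k\<close> and \<open>k + 1\<close> mean an arrow from \<open>k + 1\<close> to
  \<open>k\<close>, different ones at \<open>k - 1\<close> and \<open>k\<close> an arrow from
  \<open>k - 1\<close> to \<open>k\<close>; so each \<open>k\<close> is a sink when mutated.\<close>

primrec column_sequence :: "(nat \<Rightarrow> nat) \<Rightarrow> nat list \<Rightarrow> bool" where
  "column_sequence p [] \<longleftrightarrow> True"
| "column_sequence p (k # S) \<longleftrightarrow>
    1 \<le> k \<and> p (k + 1) = p k \<and> (2 \<le> k \<longrightarrow> p (k - 1) = p k + 1) \<and>
    column_sequence (p(k := p k + 1)) S"

abbreviation shift :: "(nat \<Rightarrow> nat) \<Rightarrow> nat list \<Rightarrow> nat \<Rightarrow> nat" where
  "shift \<equiv> foldl (\<lambda>p k. p(k := p k + 1))"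

lemma column_sequence_append:
  "column_sequence p (S @ S') \<longleftrightarrow> column_sequence p S \<and> column_sequence (shift p S) S'"
  by (induction S arbitrary: p) auto

context bipartite_quiver
begin

lemma admissible_list_lift:
  assumes "column_sequence p S" "\<forall>u \<in> verts Q. \<forall>i \<ge> 1. \<alpha> (u, i) = p i"
  shows "admissible_list \<alpha> (lift_sequence Q S) \<and>
    (\<forall>u \<in> verts Q. \<forall>i \<ge> 1. foldl bump \<alpha> (lift_sequence Q S) (u, i) = shift p S i)"
  using assms
proof (induction S arbitrary: \<alpha> p)
  case Nil
  then show ?case by (simp add: lift_sequence_def)
next
  case (Cons k S)
  let ?V1 = "{u \<in> verts Q. is_source Q u}" and ?V2 = "{u \<in> verts Q. \<not> is_source Q u}"
  define L1 where "L1 = sorted_list_of_set ?V1"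
  define L2 where "L2 = sorted_list_of_set ?V2"
  have L: "distinct L1" "distinct L2" "set L1 = ?V1" "set L2 = ?V2"
    using finite_verts by (simp_all add: L1_def L2_def)
  let ?c = "\<lambda>L. map (\<lambda>u. (u, k)) L"
  have k: "1 \<le> k" "p (k + 1) = p k" "2 \<le> k \<longrightarrow> p (k - 1) = p k + 1"
    using Cons.prems(1) by auto
  \<comment> \<open>A column is done in two halves: first the sources with \<open>M\<close> empty,
    then the sinks with \<open>M\<close> the set of all sources, which contains every neighbour of a
    sink.\<close>
  have "admissible_list \<alpha> (?c L1) \<and>
      foldl bump \<alpha> (?c L1) = (\<lambda>q. \<alpha> q + of_bool (snd q = k \<and> fst q \<in> set L1))"
    by (rule admissible_list_column[where M = "{}" and a = "p k"])
      (use L k Cons.prems(2) adj_source in simp_all)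
  then have 1: "admissible_list \<alpha> (?c L1)"
      "foldl bump \<alpha> (?c L1) = (\<lambda>q. \<alpha> q + of_bool (snd q = k \<and> fst q \<in> set L1))"
    by blast+
  define \<beta> where "\<beta> = foldl bump \<alpha> (?c L1)"
  have \<beta>: "\<beta> (u, i) = p i + of_bool (i = k \<and> u \<in> set L1)" if "u \<in> verts Q" "1 \<le> i" for u i
    using Cons.prems(2) that by (simp add: \<beta>_def 1(2))
  have "admissible_list \<beta> (?c L2) \<and>
      foldl bump \<beta> (?c L2) = (\<lambda>q. \<beta> q + of_bool (snd q = k \<and> fst q \<in> set L2))"
  proof (rule admissible_list_column[where M = "set L1" and a = "p k"])
    show "\<forall>v \<in> set L2. \<forall>u. adj v u \<noteq> 0 \<longrightarrow>
        (if is_source Q v then u \<notin> set L1 \<union> set L2 else u \<in> set L1)"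
    proof (intro ballI allI impI)
      fix v u assume "v \<in> set L2" "adj v u \<noteq> 0"
      then show "if is_source Q v then u \<notin> set L1 \<union> set L2 else u \<in> set L1"
        using adj_source[of v u] adj_verts[of v u] L(3,4) by simp
    qed
    have "k - 1 \<noteq> k" using k(1) by simp
    then show "2 \<le> k \<longrightarrow> (\<forall>u \<in> verts Q. \<beta> (u, k - 1) = p k + 1)"
      using k(3) by (simp add: \<beta>)
  qed (use L k in \<open>simp_all add: \<beta> disjoint_iff\<close>)
  then have 2: "admissible_list \<beta> (?c L2)"
      "foldl bump \<beta> (?c L2) = (\<lambda>q. \<beta> q + of_bool (snd q = k \<and> fst q \<in> set L2))"
    by blast+
  define \<gamma> where "\<gamma> = foldl bump \<beta> (?c L2)"
  have "\<forall>u \<in> verts Q. \<forall>i \<ge> 1. \<gamma> (u, i) = (p(k := p k + 1)) i"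
    using L by (auto simp: \<gamma>_def 2(2) \<beta>)
  moreover have "column_sequence (p(k := p k + 1)) S"
    using Cons.prems(1) by simp
  ultimately have "admissible_list \<gamma> (lift_sequence Q S) \<and>
      (\<forall>u \<in> verts Q. \<forall>i \<ge> 1. foldl bump \<gamma> (lift_sequence Q S) (u, i) = shift p (k # S) i)"
    unfolding foldl.simps by (intro Cons.IH)
  moreover have "lift_sequence Q (k # S) = ?c L1 @ ?c L2 @ lift_sequence Q S"
    by (simp add: lift_sequence_def source_sink_list_def L1_def L2_def)
  ultimately show ?case
    using 1(1) 2(1) unfolding \<beta>_def \<gamma>_def by (simp only: admissible_list_append foldl_append) blast
qed

end

lemma sink_green_sequence_column:
  assumes "column_sequence (\<lambda>_. 0) S"
  shows "sink_green_sequence A_infinity S"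
proof -
  \<comment> \<open>\<open>A_infinity\<close> is the triangular product with a one-vertex quiver.\<close>
  define Q1 :: "nat quiver" where "Q1 = \<lparr>verts = {0}, arr = \<lambda>_ _. 0\<rparr>"
  interpret bipartite_quiver Q1
    by unfold_locales (auto simp: Q1_def is_source_def)
  let ?f = "\<lambda>k :: nat. (0 :: nat, k)"
  have lift: "lift_sequence Q1 S = map ?f S"
    by (induction S) (auto simp: lift_sequence_def source_sink_list_def Q1_def is_source_def)
  have adm: "admissible_list (\<lambda>_. 0) (map ?f S)"
    using admissible_list_lift[OF assms, of "\<lambda>_. 0"] by (simp add: lift)
  have f: "inj ?f" "arr A_infinity i j = arr (Q1 \<boxtimes> A_infinity) (?f i) (?f j)"
    "i \<in> verts A_infinity \<longleftrightarrow> ?f i \<in> verts (Q1 \<boxtimes> A_infinity)" for i j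
    by (auto simp: inj_def triangular_product_def Q1_def)
  have green: "green_sequence (Q1 \<boxtimes> A_infinity) (map ?f S)"
    by (rule green_sequence_admissible[OF adm])
  show ?thesis
    unfolding sink_green_sequence_def
  proof
    show "green_sequence A_infinity S"
      using green f(3) unfolding green_sequence_def is_green_def
      by (simp add: mutate_list_framed_inj[OF f] take_map)
    show "\<forall>j < length S. is_sink (mutate_list A_infinity (take j S)) (S ! j)"
    proof (intro allI impI)
      fix j assume j: "j < length S"
      then have adm: "admissible_list (\<lambda>_. 0) (map ?f (take j S))"
        "admissible (state_after (map ?f (take j S))) (0, S ! j)"
        using admissible_list_nth[OF adm, of j] by (simp_all add: take_map)
      \<comment> \<open>Arrows from an admissible vertex to unfrozen vertices are counted by
        \<open>adj\<close>, which vanishes for \<open>Q1\<close>.\<close>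
      show "is_sink (mutate_list A_infinity (take j S)) (S ! j)"
        unfolding is_sink_def mutate_list_framed[of A_infinity] mutate_list_framed_inj[OF f]
        using arr_admissible(2)[OF adm(2) represents_framed_after[OF adm(1)]]
        by (simp add: adj_def)
    qed
  qed
qed


section \<open>Sink sequences with prescribed shifts\<close>

text \<open>When the sweep reaches \<open>k\<close>, column \<open>k - 1\<close> has just risen to
  \<open>t + 1\<close> and column \<open>k + 1\<close> is still at \<open>t\<close>; for the last
  step this uses the value at \<open>m + 1\<close>.\<close>

lemma column_sequence_round:
  assumes "\<And>k. 1 \<le> k \<Longrightarrow> k \<le> m + 1 \<Longrightarrow> p k = t"
  shows "column_sequence p [1..<Suc m] \<and>
    shift p [1..<Suc m] = (\<lambda>k. p k + of_bool (1 \<le> k \<and> k \<le> m))"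
proof -
  have "column_sequence p [1..<Suc n] \<and>
    shift p [1..<Suc n] = (\<lambda>k. p k + of_bool (1 \<le> k \<and> k \<le> n))" if "n \<le> m" for n
    using that
  proof (induction n)
    case (Suc n)
    then have IH: "column_sequence p [1..<Suc n]"
      "shift p [1..<Suc n] = (\<lambda>k. p k + of_bool (1 \<le> k \<and> k \<le> n))"
      by (meson Suc_leD)+
    have "p (Suc (Suc n)) = t" "p (Suc n) = t" "1 \<le> n \<longrightarrow> p n = t"
      using assms Suc.prems by auto
    moreover have "[1..<Suc (Suc n)] = [1..<Suc n] @ [Suc n]" by simp
    ultimately show ?case
      by (simp only: column_sequence_append foldl_append IH) (auto simp: fun_eq_iff)
  qed (auto simp: fun_eq_iff)
  then show ?thesis by blast
qed

lemma down_closed_initial_segment: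
  fixes P :: "nat \<Rightarrow> bool"
  assumes "\<And>k. 1 \<le> k \<Longrightarrow> P (Suc k) \<Longrightarrow> P k" "\<And>k. B \<le> k \<Longrightarrow> \<not> P k"
  obtains m where "\<And>k. 1 \<le> k \<Longrightarrow> P k \<longleftrightarrow> k \<le> m"
proof -
  define m where "m = (LEAST m. \<not> P (Suc m))"
  have m: "\<not> P (Suc m)" unfolding m_def
    by (rule LeastI[of _ B]) (use assms(2) in simp)
  have "P k" if "1 \<le> k" "k \<le> m" for k
    using not_less_Least[of "k - 1" "\<lambda>m. \<not> P (Suc m)"] that by (auto simp: m_def)
  moreover have "\<not> P k" if "m < k" for k
    using that m
  proof (induction k rule: less_induct)
    case (less k)
    then obtain l where l: "k = Suc l" "m \<le> l" by (cases k) auto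
    show ?case
    proof (cases "l = m")
      case False
      then have "\<not> P l" using less l by simp
      then show ?thesis using assms(1)[of l] l False by auto
    qed (use less l in simp)
  qed
  ultimately show thesis using that by (metis not_le)
qed

text \<open>The profile is built level by level: after \<open>t\<close> rounds column
  \<open>k\<close> stands at \<open>min (p k) t\<close>, and the next round sweeps the columns with
  \<open>t < p k\<close>.\<close>

lemma column_sequence_exists:
  assumes "\<And>k. p (Suc k) \<le> p k" "\<And>k. p k \<le> Suc (p (Suc k))" "\<And>k. B \<le> k \<Longrightarrow> p k = 0"
  shows "\<exists>S. column_sequence (\<lambda>_. 0) S \<and> (\<forall>k \<ge> 1. shift (\<lambda>_. 0) S k = p k)"
proof -
  have "\<exists>S. column_sequence (\<lambda>_. 0) S \<and> (\<forall>k \<ge> 1. shift (\<lambda>_. 0) S k = min (p k) t)" for t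
  proof (induction t)
    case 0
    show ?case by (rule exI[of _ "[]"]) simp
  next
    case (Suc t)
    then obtain S where S: "column_sequence (\<lambda>_. 0) S" "\<forall>k \<ge> 1. shift (\<lambda>_. 0) S k = min (p k) t"
      by blast
    obtain m where m: "\<And>k. 1 \<le> k \<Longrightarrow> t < p k \<longleftrightarrow> k \<le> m"
    proof (rule down_closed_initial_segment[of "\<lambda>k. t < p k" B])
      show "t < p k" if "t < p (Suc k)" for k
        using that assms(1)[of k] by simp
      show "\<not> t < p k" if "B \<le> k" for k
        using assms(3)[OF that] by simp
    qed blast
    \<comment> \<open>Since \<open>p m\<close> exceeds \<open>t\<close> and \<open>p\<close> drops
      by at most 1, column \<open>m + 1\<close> has reached level \<open>t\<close>, as the round
      requires.\<close>
    have "t \<le> p (m + 1)" if "1 \<le> m"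
      using m[of m] that assms(2)[of m] by simp
    \<comment> \<open>For \<open>m = 0\<close> the round is empty, and column 1 may have stopped
      below \<open>t\<close>.\<close>
    then have "m = 0 \<or> shift (\<lambda>_. 0) S (m + 1) = t"
      using S(2) by (cases "m = 0") auto
    then have round: "column_sequence (shift (\<lambda>_. 0) S) [1..<Suc m] \<and> shift (shift (\<lambda>_. 0) S) [1..<Suc m] =
        (\<lambda>k. shift (\<lambda>_. 0) S k + of_bool (1 \<le> k \<and> k \<le> m))"
    proof
      assume "m = 0"
      then show ?thesis by (auto simp: fun_eq_iff)
    next
      assume last: "shift (\<lambda>_. 0) S (m + 1) = t"
      show ?thesis
      proof (rule column_sequence_round)
        fix k assume k: "1 \<le> k" "k \<le> m + 1"
        show "shift (\<lambda>_. 0) S k = t"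
        proof (cases "k = m + 1")
          case False
          then have "t < p k" using m[OF k(1)] k(2) by simp
          then show ?thesis using S(2) k(1) by simp
        qed (use last in simp)
      qed
    qed
    have step: "min (p k) t + of_bool (1 \<le> k \<and> k \<le> m) = min (p k) (Suc t)" if "1 \<le> k" for k
      using m[OF that] that by auto
    show ?case
    proof (intro exI conjI allI impI)
      show "column_sequence (\<lambda>_. 0) (S @ [1..<Suc m])"
        using S(1) round unfolding column_sequence_append by blast
      fix k :: nat assume "1 \<le> k"
      then have "shift (\<lambda>_. 0) S k = min (p k) t" using S(2) by blast
      then show "shift (\<lambda>_. 0) (S @ [1..<Suc m]) k = min (p k) (Suc t)"
        unfolding foldl_append conjunct2[OF round] step[OF \<open>1 \<le> k\<close>, symmetric] by (rule arg_cong)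
    qed
  qed
  \<comment> \<open>\<open>p\<close> is antitone, so \<open>p 0\<close> rounds reach all its
    values.\<close>
  from this[of "p 0"] obtain S where "column_sequence (\<lambda>_. 0) S"
    "\<forall>k \<ge> 1. shift (\<lambda>_. 0) S k = min (p k) (p 0)" by blast
  moreover have "min (p k) (p 0) = p k" for k
    using assms(1) lift_Suc_antimono_le[of p 0 k] by simp
  ultimately show ?thesis by auto
qed

lemma nested_intervals_profile:
  assumes "finite N" "nested N"
  obtains p :: "nat \<Rightarrow> nat" and B where
    "\<And>k. p (Suc k) \<le> p k" "\<And>k. p k \<le> Suc (p (Suc k))" "\<And>k. B \<le> k \<Longrightarrow> p k = 0"
    "\<And>a b. 1 \<le> b \<Longrightarrow> {a + 1..a + b} \<in> N \<Longrightarrow> p b = a"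
proof -
  define J where "J = {(a, b). 1 \<le> b \<and> {a + 1..a + b} \<in> N}"
  \<comment> \<open>The intervals are nonempty because \<open>1 \<le> b\<close>, so they determine
    their end points; this makes \<open>J\<close> finite.\<close>
  have "inj_on (\<lambda>(a, b). {a + 1..a + b}) J"
    by (auto simp: inj_on_def J_def Icc_eq_Icc)
  moreover have "(\<lambda>(a, b). {a + 1..a + b}) ` J \<subseteq> N"
    by (auto simp: J_def)
  ultimately have "finite J"
    using assms(1) inj_on_finite by blast
  \<comment> \<open>With truncated subtraction, each \<open>a - (k - b)\<close> is \<open>a\<close> up to \<open>k = b\<close> and then drops to 0 in steps of 1.
    Nestedness says that no other pair exceeds \<open>a\<close> at \<open>k = b\<close>.\<close>
  define p where "p k = Max (insert 0 ((\<lambda>(a, b). a - (k - b)) ` J))" for k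
  have p_le: "p k \<le> c \<longleftrightarrow> (\<forall>(a, b) \<in> J. a - (k - b) \<le> c)" for k c
    using \<open>finite J\<close> unfolding p_def by (subst Max_le_iff) auto
  have p_ge: "a - (k - b) \<le> p k" if "(a, b) \<in> J" for a b k
    using p_le[of k "p k"] that by auto
  \<comment> \<open>The contribution \<open>a - (k - b)\<close> of a pair is 0 from
    \<open>k = a + b\<close> on.\<close>
  define B where "B = Max (insert 0 ((\<lambda>(a, b). a + b) ` J))"
  have B: "a + b \<le> B" if "(a, b) \<in> J" for a b
    using \<open>finite J\<close> that unfolding B_def by (intro Max_ge) force+
  show thesis
  proof (rule that[of p B])
    show "p (Suc k) \<le> p k" for k
      unfolding p_le using p_ge[of _ _ k] by fastforce
    show "p k \<le> Suc (p (Suc k))" for k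
      unfolding p_le using p_ge[of _ _ "Suc k"] by fastforce
    show "p k = 0" if "B \<le> k" for k
      using p_le[of k 0] B that by fastforce
    show "p b = a" if ab: "1 \<le> b" "{a + 1..a + b} \<in> N" for a b
    proof (rule antisym)
      show "a \<le> p b"
        using p_ge[of a b b] ab by (simp add: J_def)
      show "p b \<le> a"
        unfolding p_le
      proof clarify
        fix c d assume "(c, d) \<in> J"
        then have "1 \<le> d" "{c + 1..c + d} \<in> N" by (auto simp: J_def)
        then have "{c + 1..c + d} \<subseteq> {a + 1..a + b} \<or> {a + 1..a + b} \<subseteq> {c + 1..c + d}"
          using assms(2) ab unfolding nested_def by blast
        \<comment> \<open>In the first case \<open>c + d \<le> a + b\<close> and
          \<open>d \<le> b\<close>; in the second already \<open>c \<le> a\<close>.\<close>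
        then show "c - (b - d) \<le> a"
          using ab \<open>1 \<le> d\<close> by auto
      qed
    qed
  qed
qed

section \<open>Alternating Dynkin quivers and the final assembly\<close>

lemma bipartite_quiver_alternating:
  assumes "alternating_dynkin_quiver T Q"
  shows "bipartite_quiver Q"
proof
  have valid: "dynkin_valid T" and verts: "verts Q = {1..rank T}"
    and arr: "arr Q i j + arr Q j i = (if dynkin_edge T i j \<or> dynkin_edge T j i then 1 else 0)"
    for i j
    using assms by (auto simp: alternating_dynkin_quiver_def)
  show "finite (verts Q)" by (simp add: verts)
  have "i \<in> {1..rank T} \<and> j \<in> {1..rank T}" if "dynkin_edge T i j" for i j
    using that valid by (cases T) auto
  then show "u \<in> verts Q \<and> w \<in> verts Q" if "arr Q u w \<noteq> 0" for u w
    using arr[of u w] that by (auto simp: verts split: if_splits)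
  show "is_source Q v \<or> is_sink Q v" if "v \<in> verts Q" for v
    using assms that by (auto simp: alternating_dynkin_quiver_def)
qed

theorem theorem7p4:
  fixes Q :: "nat quiver" and T :: dynkin_type and N :: "nat set set"
  assumes "alternating_dynkin_quiver T Q"
    and "finite N"
    and "\<forall>I \<in> N. \<exists>a b. 1 \<le> b \<and> I = {a + 1..a + b}"
    and "nested N"
  shows "\<exists>S :: nat list.
    sink_green_sequence A_infinity S \<and>
    green_sequence (Q \<boxtimes> A_infinity) (lift_sequence Q S) \<and>
    (\<forall>v \<in> verts Q. \<forall>a b. 1 \<le> b \<and> {a + 1..a + b} \<in> N \<longrightarrow>
      (\<exists>w \<in> verts (Q \<boxtimes> A_infinity).
        is_g_vector (Q \<boxtimes> A_infinity) (lift_sequence Q S) w (e (v, a + b) - e (v, a))))"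
proof -
  interpret bipartite_quiver Q
    by (rule bipartite_quiver_alternating[OF assms(1)])
  obtain p B where p: "\<And>k. p (Suc k) \<le> p k" "\<And>k. p k \<le> Suc (p (Suc k))" "\<And>k. B \<le> k \<Longrightarrow> p k = 0"
    "\<And>a b. 1 \<le> b \<Longrightarrow> {a + 1..a + b} \<in> N \<Longrightarrow> p b = a"
    by (rule nested_intervals_profile[OF assms(2,4)]) blast
  obtain S where S: "column_sequence (\<lambda>_. 0) S" "\<forall>k \<ge> 1. shift (\<lambda>_. 0) S k = p k"
    using column_sequence_exists[of p B] p(1-3) by blast
  have adm: "admissible_list (\<lambda>_. 0) (lift_sequence Q S)"
    and state: "v \<in> verts Q \<Longrightarrow> 1 \<le> b \<Longrightarrow> state_after (lift_sequence Q S) (v, b) = p b" for v b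
    using admissible_list_lift[OF S(1), of "\<lambda>_. 0"] S(2) by auto
  show ?thesis
  proof (intro exI[of _ S] conjI ballI allI impI)
    show "sink_green_sequence A_infinity S"
      by (rule sink_green_sequence_column[OF S(1)])
    show "green_sequence (Q \<boxtimes> A_infinity) (lift_sequence Q S)"
      by (rule green_sequence_admissible[OF adm])
    fix v a b assume v: "v \<in> verts Q" and "1 \<le> b \<and> {a + 1..a + b} \<in> N"
    then have b: "1 \<le> b" "p b = a" using p(4) by auto
    \<comment> \<open>The variable sought sits at \<open>(v, b)\<close>: the length of the interval
      is the column, its offset \<open>a\<close> the number of mutations there.\<close>
    have "is_g_vector (Q \<boxtimes> A_infinity) (lift_sequence Q S) (v, b) (e (v, a + b) - e (v, a))"
      using is_g_vector_admissible[OF adm v b(1)] state[OF v b(1)] b(2) by simp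
    moreover have "(v, b) \<in> verts (Q \<boxtimes> A_infinity)"
      using v b(1) by (simp add: triangular_product_def A_infinity_def)
    ultimately show "\<exists>w \<in> verts (Q \<boxtimes> A_infinity).
        is_g_vector (Q \<boxtimes> A_infinity) (lift_sequence Q S) w (e (v, a + b) - e (v, a))" by blast
  qed
qed

end
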